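(* Let $\kappa>0$ with $\kappa\ne8$, let $(B_t)_{t\ge 0}$ be a standard linear Brownian motion, let $(g_t)_{t\ge0}$ be the (forward) Loewner flow driven by $\xi_t=\sqrt\kappa B_t$, and let $\hat f_t(z)=g_t^{-1}(z+\xi_t)$ for $z\in\mathbb H$. Set $$q=\frac4\kappa+\frac{\kappa}{16}+1 .$$ Then for any $\delta>0$ there exist $C>0$ and $\varepsilon>0$ such that for all $t\in[0,1]$ and $y\in(0,1)$, $$\mathbb P\left[|\hat f_t'(iy)|>y^{-(1-\varepsilon)}\right]\le C y^{q-\delta}.$$
   Context: $\mathbb H=\{z\in\mathbb C:\Im z>0\}$. For a continuous real-valued function $(\xi_t)_{t\ge0}$, the (forward) Loewner flow driven by $\xi$ is the family $(g_t)_{t\ge 0}$ where, for each $z\in\mathbb H$, $t\mapsto g_t(z)$ is the maximal solution of $dg_t(z)=\frac{2}{g_t(z)-\xi_t}\,dt$, $g_0(z)=z$, defined up to the maximal time $\zeta(z)$ at which $|g_t(z)-\xi_t|\to0$. With $H_t=\{z\in\mathbb H: t<\zeta(z)\}$, the map $g_t$ is a conformal isomorphism from $H_t$ onto $\mathbb H$. The prime denotes the complex derivative in $z$. *)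

theory Defs
  imports "HOL-Probability.Probability" "HOL-Complex_Analysis.Complex_Analysis"
begin

text \<open>
  Only the values \<open>B t\<close> with \<open>t \<ge> 0\<close> matter. All paths are continuous, so that the Loewner
  flow driven by a multiple of the Brownian motion is defined for every outcome.
\<close>

locale standard_brownian_motion = prob_space M
  for M :: "'a measure" and B :: "real \<Rightarrow> 'a \<Rightarrow> real" +
  assumes measurable: "\<And>t. 0 \<le> t \<Longrightarrow> random_variable borel (B t)"
    and starts_at_zero: "AE \<omega> in M. B 0 \<omega> = 0"
    and independent_increments:
      "\<And>(\<tau> :: nat \<Rightarrow> real) n. 0 \<le> \<tau> 0 \<Longrightarrow> mono \<tau> \<Longrightarrow>
        indep_vars (\<lambda>_. borel) (\<lambda>i \<omega>. B (\<tau> (Suc i)) \<omega> - B (\<tau> i) \<omega>) {..<n}"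
    and gaussian_increments:
      "\<And>s t. 0 \<le> s \<Longrightarrow> s < t \<Longrightarrow>
        distributed M lborel (\<lambda>\<omega>. B t \<omega> - B s \<omega>) (normal_density 0 (sqrt (t - s)))"
    and continuous_paths: "\<And>\<omega>. \<omega> \<in> space M \<Longrightarrow> continuous_on {0..} (\<lambda>t. B t \<omega>)"

definition upper_half_plane :: "complex set" where
  "upper_half_plane = {z. 0 < Im z}"

text \<open>
  \<open>u\<close> solves the Loewner equation started from \<open>z\<close> on the time interval \<open>[0, T)\<close>, where
  \<open>T = \<infinity>\<close> is allowed. The condition \<open>u t \<noteq> \<xi> t\<close> is needed because division is total:
  the right-hand side would otherwise be \<open>0\<close> at a collision.
\<close>

definition loewner_solution ::
    "(real \<Rightarrow> real) \<Rightarrow> complex \<Rightarrow> ereal \<Rightarrow> (real \<Rightarrow> complex) \<Rightarrow> bool" where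
  "loewner_solution \<xi> z T u \<longleftrightarrow>
     u 0 = z \<and>
     (\<forall>t\<ge>0. ereal t < T \<longrightarrow>
        u t \<noteq> of_real (\<xi> t) \<and>
        (u has_vector_derivative 2 / (u t - of_real (\<xi> t))) (at t within {0..}))"

text \<open>
  The maximal existence time \<open>\<zeta>(z)\<close>. Since the vector field is locally Lipschitz away from the
  collision \<open>u t = \<xi> t\<close> and the trajectories from the upper half-plane stay bounded on bounded
  time intervals, a finite \<open>\<zeta>(z)\<close> is the time at which \<open>\<bar>g\<^sub>t(z) - \<xi>\<^sub>t\<bar> \<rightarrow> 0\<close>.
\<close>

definition loewner_lifetime :: "(real \<Rightarrow> real) \<Rightarrow> complex \<Rightarrow> ereal" where
  "loewner_lifetime \<xi> z = Sup {T. \<exists>u. loewner_solution \<xi> z T u}"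

text \<open>
  The maximal solution \<open>g\<^sub>t(z)\<close>. By uniqueness of solutions, the value does not depend on the
  choice for \<open>0 \<le> t < \<zeta>(z)\<close>; for other \<open>t\<close> it is meaningless.
\<close>

definition loewner_flow :: "(real \<Rightarrow> real) \<Rightarrow> real \<Rightarrow> complex \<Rightarrow> complex" where
  "loewner_flow \<xi> t z = (SOME u. loewner_solution \<xi> z (loewner_lifetime \<xi> z) u) t"

definition loewner_domain :: "(real \<Rightarrow> real) \<Rightarrow> real \<Rightarrow> complex set" where
  "loewner_domain \<xi> t = {z \<in> upper_half_plane. ereal t < loewner_lifetime \<xi> z}"

text \<open>\<open>f\<^sub>t(z) = g\<^sub>t\<^sup>-\<^sup>1(z + \<xi>\<^sub>t)\<close>, with \<open>g\<^sub>t\<close> regarded as a map on its domain \<open>H\<^sub>t\<close>.\<close>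

definition loewner_fhat :: "(real \<Rightarrow> real) \<Rightarrow> real \<Rightarrow> complex \<Rightarrow> complex" where
  "loewner_fhat \<xi> t z = inv_into (loewner_domain \<xi> t) (loewner_flow \<xi> t) (z + of_real (\<xi> t))"

end

theory Submission imports Defs begin

text \<open>
  The plan is the classical one for moments of the derivative of SLE. Time reversal turns \<open>g\<^sub>t\<^sup>-\<^sup>1\<close> into the
  reverse Loewner flow: in coordinates centred at the driving point, \<open>Z = X + \<i> Y\<close> solves
  \<open>dZ = - 2/Z ds + d\<xi>\<close>, and its derivative \<open>d\<close> in the starting point at time \<open>t\<close> is the derivative of
  \<open>loewner_fhat\<close>. By Ito's formula \<open>F = \<bar>d\<bar> powr \<mu> * Y powr (\<zeta> - r) * \<bar>Z\<bar> powr r\<close> is a local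
  martingale when \<open>\<mu> = r + \<kappa> r / 4 - \<kappa> r\<^sup>2 / 8\<close> and \<open>\<zeta> = r - \<kappa> r\<^sup>2 / 8\<close>. Started from \<open>\<i> y\<close> it
  has the value \<open>y powr \<zeta>\<close>. On the event \<open>\<bar>d\<bar> > y powr (- (1 - \<epsilon>))\<close> the inequality \<open>\<bar>d\<bar> y \<le> Y\<close> confines
  \<open>Y\<close> between \<open>y powr \<epsilon>\<close> and a constant, so that \<open>F\<close> is at least of order
  \<open>y powr (- \<mu> + O(\<epsilon>))\<close>. Markov's inequality gives the exponent \<open>\<mu> + \<zeta>\<close>, and its
  maximum over \<open>r\<close>, attained at \<open>r = 4/\<kappa> + 1/2\<close>, is \<open>q\<close>.

  The argument is carried out without stochastic integration. The reverse flow is replaced by its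
  Euler scheme with step \<open>h = t/n\<close>. Every step is a holomorphic map followed by an independent Gaussian
  translation, so the expectation of \<open>F\<close> after a step can be estimated directly: the linear drift term
  (\<open>euler_step_functional_le\<close>) and the second-order term of the Gaussian translation
  (\<open>nn_integral_gaussian_shift_norm_powr_le\<close>) cancel by the choice of the exponents, and the relative
  error is of order \<open>h powr (3/2)\<close> for fixed \<open>y\<close>
  (\<open>nn_integral_rev_loewner_functional_step_le\<close>). Over \<open>n\<close> steps the errors add up to
  \<open>O(n powr (- 1/2))\<close>. The tail bound for the scheme thus has constants independent of \<open>n\<close>, \<open>t\<close> and \<open>y\<close>, once \<open>n\<close> is
  large depending on \<open>t\<close> and \<open>y\<close>.

  The passage to the limit is pathwise (\<open>euler_deriv_tendsto\<close>). For a continuous driving function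
  the scheme converges to \<open>loewner_fhat\<close> locally uniformly in the upper half-plane, hence so do the
  derivatives, and a Fatou argument transfers the tail bound. This needs existence of a
  solution through a prescribed point at time \<open>t\<close> (\<open>loewner_solution_through\<close>) and uniqueness
  forward and backward in time (\<open>loewner_solution_eq_iff\<close>), which together identify the inverse of
  the flow (\<open>loewner_fhat_eq\<close>).
\<close>

section \<open>Uniqueness for the Loewner equation and the maximal flow\<close>

text \<open>
  The integrating factor \<open>exp (- \<integral> c)\<close> makes \<open>d\<close> constant. The point of the explicit solution is that it
  vanishes at one end of the interval iff it vanishes at the other, so it gives uniqueness forward and
  backward in time at once.
\<close>

lemma linear_ode_solution:
  fixes d c :: "real \<Rightarrow> complex"
  assumes "a \<le> b" and cont: "continuous_on {a..b} c"
    and deriv: "\<And>s. s \<in> {a..b} \<Longrightarrow> (d has_vector_derivative c s * d s) (at s within {a..b})"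
  shows "d b = d a * exp (integral {a..b} c)"
proof -
  let ?E = "\<lambda>s. exp (- integral {a..s} c)"
  have E: "(?E has_vector_derivative - c s * ?E s) (at s within {a..b})" if "s \<in> {a..b}" for s
  proof -
    have "((\<lambda>s. - integral {a..s} c) has_vector_derivative - c s) (at s within {a..b})"
      by (intro has_vector_derivative_minus integral_has_vector_derivative cont that)
    from field_vector_diff_chain_within[OF this, of exp "exp (- integral {a..s} c)"]
    show ?thesis
      by (simp add: o_def DERIV_exp has_field_derivative_at_within)
  qed
  have "((\<lambda>s. d s * ?E s) has_vector_derivative 0) (at s within {a..b})" if "s \<in> {a..b}" for s
    using has_vector_derivative_mult[OF deriv[OF that] E[OF that]] by (simp add: algebra_simps)
  then obtain k where k: "\<And>s. s \<in> {a..b} \<Longrightarrow> d s * ?E s = k"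
    using has_vector_derivative_zero_constant[of "{a..b}" "\<lambda>s. d s * ?E s"] by auto
  have "d a * ?E a = d b * ?E b"
    using k[of a] k[of b] \<open>a \<le> b\<close> by simp
  then show ?thesis
    by (simp add: exp_minus field_simps)
qed

lemma loewner_solution_continuous_on:
  assumes "loewner_solution \<xi> z T u" and "ereal s < T"
  shows "continuous_on {0..s} u"
proof (rule continuous_on_vector_derivative)
  fix x assume "x \<in> {0..s}"
  then have "0 \<le> x" "ereal x < T"
    using assms(2) by (auto intro: le_less_trans[of "ereal x" "ereal s"])
  then show "(u has_vector_derivative 2 / (u x - of_real (\<xi> x))) (at x within {0..s})"
    using assms(1) unfolding loewner_solution_def
    by (auto intro: has_vector_derivative_within_subset[where S="{0..}"])
qed

text \<open>
  The difference \<open>d = u1 - u2\<close> of two solutions satisfies the linear equation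
  \<open>d' = - 2 d / ((u1 - \<xi>) (u2 - \<xi>))\<close>, whose coefficient is continuous as long as neither solution has
  collided with \<open>\<xi>\<close>. From right to left this is uniqueness of the flow; from left to right
  it is injectivity of \<open>g\<^sub>t\<close>.
\<close>

lemma loewner_solution_eq_iff:
  assumes \<xi>: "continuous_on {0..} \<xi>"
    and u: "loewner_solution \<xi> z1 T1 u1" "loewner_solution \<xi> z2 T2 u2"
    and s: "0 \<le> s" "ereal s < T1" "ereal s < T2"
  shows "u1 s = u2 s \<longleftrightarrow> z1 = z2"
proof -
  let ?c = "\<lambda>s. - 2 / ((u1 s - of_real (\<xi> s)) * (u2 s - of_real (\<xi> s)))"
  have lt: "ereal x < T1" "ereal x < T2" if "x \<in> {0..s}" for x
    using that s by (auto intro: le_less_trans[of "ereal x" "ereal s"])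
  have ne: "u1 x \<noteq> of_real (\<xi> x)" "u2 x \<noteq> of_real (\<xi> x)" if "x \<in> {0..s}" for x
    using u lt[OF that] that by (auto simp: loewner_solution_def)
  have "u1 s - u2 s = (u1 0 - u2 0) * exp (integral {0..s} ?c)"
  proof (rule linear_ode_solution[OF s(1)])
    show "continuous_on {0..s} ?c"
      using ne
      by (intro continuous_intros loewner_solution_continuous_on[OF u(1) s(2)]
            loewner_solution_continuous_on[OF u(2) s(3)] continuous_on_subset[OF \<xi>]) auto
    fix x assume x: "x \<in> {0..s}"
    have "(u1 has_vector_derivative 2 / (u1 x - of_real (\<xi> x))) (at x within {0..s})"
         "(u2 has_vector_derivative 2 / (u2 x - of_real (\<xi> x))) (at x within {0..s})"
      using u lt[OF x] x unfolding loewner_solution_def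
      by (auto intro: has_vector_derivative_within_subset[where S="{0..}"])
    then have "((\<lambda>s. u1 s - u2 s) has_vector_derivative
        2 / (u1 x - of_real (\<xi> x)) - 2 / (u2 x - of_real (\<xi> x))) (at x within {0..s})"
      by (rule has_vector_derivative_diff)
    also have "2 / (u1 x - of_real (\<xi> x)) - 2 / (u2 x - of_real (\<xi> x)) = ?c x * (u1 x - u2 x)"
      using ne[OF x] by (simp add: divide_simps)
    finally show "((\<lambda>s. u1 s - u2 s) has_vector_derivative ?c x * (u1 x - u2 x)) (at x within {0..s})" .
  qed
  then have "u1 s - u2 s = 0 \<longleftrightarrow> u1 0 - u2 0 = 0"
    by (simp only: mult_eq_0_iff exp_not_eq_zero) simp
  then show ?thesis
    using u by (simp add: loewner_solution_def)
qed

text \<open>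
  The lifetime is a supremum, so it need not be attained by a single solution a priori. It is: by
  uniqueness the solutions on shorter intervals agree where they are both defined, and
  \<open>s \<mapsto> u s s\<close>, with \<open>u s\<close> a solution that lives beyond time \<open>s\<close>, is their union.
\<close>

lemma loewner_solution_up_to_lifetime:
  assumes \<xi>: "continuous_on {0..} \<xi>"
  shows "\<exists>u. loewner_solution \<xi> z (loewner_lifetime \<xi> z) u"
proof -
  let ?\<zeta> = "loewner_lifetime \<xi> z"
  have "\<exists>T u. loewner_solution \<xi> z T u \<and> ereal s < T" if "ereal s < ?\<zeta>" for s
    using that by (auto simp: loewner_lifetime_def less_Sup_iff)
  then obtain T u where u: "\<And>s. ereal s < ?\<zeta> \<Longrightarrow> loewner_solution \<xi> z (T s) (u s)"
      and T: "\<And>s. ereal s < ?\<zeta> \<Longrightarrow> ereal s < T s"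
    by metis
  let ?v = "\<lambda>s. if ereal s < ?\<zeta> then u s s else z"
  have v: "?v r = u s r" if "0 \<le> r" "ereal r < T s" "ereal s < ?\<zeta>" for r s
  proof -
    have "T s \<le> ?\<zeta>"
      unfolding loewner_lifetime_def using u[OF that(3)] by (auto intro: Sup_upper)
    then have "ereal r < ?\<zeta>"
      using that(2) by (rule less_le_trans[rotated])
    then show ?thesis
      using loewner_solution_eq_iff[OF \<xi> u[of r] u[of s] that(1)] that T[of r] by simp
  qed
  have "loewner_solution \<xi> z ?\<zeta> ?v"
    unfolding loewner_solution_def
  proof (intro conjI allI impI)
    show "?v 0 = z"
      using u[of 0] by (auto simp: loewner_solution_def zero_ereal_def)
    fix s :: real assume s: "0 \<le> s" "ereal s < ?\<zeta>"
    have sol: "u s s \<noteq> of_real (\<xi> s)"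
        "(u s has_vector_derivative 2 / (u s s - of_real (\<xi> s))) (at s within {0..})"
      using u[OF s(2)] T[OF s(2)] s(1) by (auto simp: loewner_solution_def)
    show "?v s \<noteq> of_real (\<xi> s)"
      using sol(1) s by simp
    \<comment> \<open>Near \<open>s\<close> the union coincides with the single solution \<open>u s\<close>, hence has the same derivative.\<close>
    obtain b where b: "s < b" "ereal b < T s"
      using ereal_dense2[OF T[OF s(2)]] by auto
    have "\<forall>\<^sub>F r in at s within {0..}. u s r = ?v r"
    proof -
      have "\<forall>\<^sub>F r in at s. r \<in> {..<b}"
        using b(1) by (intro eventually_at_in_open') auto
      then have "\<forall>\<^sub>F r in at s within {0..}. r \<in> {..<b}"
        by (simp add: eventually_at_filter) (auto elim: eventually_mono)
      moreover have "\<forall>\<^sub>F r in at s within {0..}. r \<in> {0..}"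
        by (simp add: eventually_at_filter)
      ultimately show ?thesis
      proof eventually_elim
        case (elim r)
        then have "ereal r < T s"
          using b(2) by (auto intro: less_trans[of "ereal r" "ereal b"])
        then show ?case
          using v[of r s] elim s(2) by simp
      qed
    qed
    with sol(2) show "(?v has_vector_derivative 2 / (?v s - of_real (\<xi> s))) (at s within {0..})"
      using s unfolding has_vector_derivative_def
      by (auto intro!: has_derivative_transform_eventually[where f="u s"])
  qed
  then show ?thesis by blast
qed

lemma loewner_flow_eq:
  assumes \<xi>: "continuous_on {0..} \<xi>"
    and u: "loewner_solution \<xi> z T u" and s: "0 \<le> s" "ereal s < T"
  shows "loewner_flow \<xi> s z = u s"
proof -
  let ?\<zeta> = "loewner_lifetime \<xi> z"
  define v where "v = (SOME u. loewner_solution \<xi> z ?\<zeta> u)"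
  have v: "loewner_solution \<xi> z ?\<zeta> v"
    unfolding v_def using loewner_solution_up_to_lifetime[OF \<xi>] by (rule someI_ex)
  have "T \<le> ?\<zeta>"
    unfolding loewner_lifetime_def using u by (auto intro: Sup_upper)
  then have "ereal s < ?\<zeta>"
    using s(2) by (rule less_le_trans[rotated])
  then have "v s = u s"
    using loewner_solution_eq_iff[OF \<xi> v u s(1) _ s(2)] by simp
  then show ?thesis
    by (simp add: loewner_flow_def v_def)
qed

lemma inj_on_loewner_flow:
  assumes \<xi>: "continuous_on {0..} \<xi>" and "0 \<le> t"
  shows "inj_on (loewner_flow \<xi> t) (loewner_domain \<xi> t)"
proof (rule inj_onI)
  fix z w assume z: "z \<in> loewner_domain \<xi> t" and w: "w \<in> loewner_domain \<xi> t"
    and eq: "loewner_flow \<xi> t z = loewner_flow \<xi> t w"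
  obtain u v where uv: "loewner_solution \<xi> z (loewner_lifetime \<xi> z) u"
      "loewner_solution \<xi> w (loewner_lifetime \<xi> w) v"
    using loewner_solution_up_to_lifetime[OF \<xi>] by metis
  have lt: "ereal t < loewner_lifetime \<xi> z" "ereal t < loewner_lifetime \<xi> w"
    using z w by (auto simp: loewner_domain_def)
  show "z = w"
    using eq loewner_solution_eq_iff[OF \<xi> uv \<open>0 \<le> t\<close> lt]
      loewner_flow_eq[OF \<xi> uv(1) \<open>0 \<le> t\<close> lt(1)] loewner_flow_eq[OF \<xi> uv(2) \<open>0 \<le> t\<close> lt(2)] by simp
qed

text \<open>
  The inverse map is evaluated by exhibiting one solution through \<open>z + \<xi>\<^sub>t\<close> at time \<open>t\<close> that starts in the
  upper half-plane and lives longer than \<open>t\<close>; injectivity of the flow excludes any other preimage.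
\<close>

lemma loewner_fhat_eq:
  assumes \<xi>: "continuous_on {0..} \<xi>"
    and u: "loewner_solution \<xi> z0 T u" and t: "0 \<le> t" "ereal t < T"
    and z0: "0 < Im z0" and z: "u t = z + of_real (\<xi> t)"
  shows "loewner_fhat \<xi> t z = z0"
proof -
  have "T \<le> loewner_lifetime \<xi> z0"
    unfolding loewner_lifetime_def using u by (auto intro: Sup_upper)
  then have "z0 \<in> loewner_domain \<xi> t"
    using z0 t(2) by (auto simp: loewner_domain_def upper_half_plane_def)
  moreover have "loewner_flow \<xi> t z0 = z + of_real (\<xi> t)"
    using loewner_flow_eq[OF \<xi> u t] z by simp
  ultimately show ?thesis
    unfolding loewner_fhat_def using inv_into_f_f[OF inj_on_loewner_flow[OF \<xi> t(1)]] by metis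
qed

section \<open>Solutions through a given point at a given time\<close>

text \<open>
  Picard iteration for a globally Lipschitz vector field, with the initial condition at an arbitrary
  time \<open>t0\<close> of the interval. In the norm weighted by \<open>exp (2 L \<bar>s - t0\<bar>)\<close> the Picard map is a
  contraction with factor \<open>1/2\<close>, so the iteration converges on the whole interval at once.
\<close>

lemma picard_lindelof_global:
  fixes f :: "real \<Rightarrow> 'a::banach \<Rightarrow> 'a"
  assumes t0: "t0 \<in> {a..b}" and "L > 0"
    and cont: "\<And>x. continuous_on {a..b} x \<Longrightarrow> continuous_on {a..b} (\<lambda>s. f s (x s))"
    and Lip: "\<And>s x y. s \<in> {a..b} \<Longrightarrow> norm (f s x - f s y) \<le> L * norm (x - y)"
  shows "\<exists>x. x t0 = x0 \<and> (\<forall>s\<in>{a..b}. (x has_vector_derivative f s (x s)) (at s within {a..b}))"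
proof -
  define P where "P x s = x0 + (integral {a..s} (\<lambda>r. f r (x r)) - integral {a..t0} (\<lambda>r. f r (x r)))"
    for x s
  define W where "W s = exp (2 * L * \<bar>s - t0\<bar>)" for s
  have W1: "1 \<le> W s" for s
    using \<open>L > 0\<close> by (simp add: W_def)
  have P_deriv: "(P x has_vector_derivative f s (x s)) (at s within {a..b})"
    if "continuous_on {a..b} x" "s \<in> {a..b}" for x s
    unfolding P_def
    using integral_has_vector_derivative[OF cont[OF that(1)] that(2)]
    by (auto intro!: derivative_eq_intros)
  have P_cont: "continuous_on {a..b} (P x)" if "continuous_on {a..b} x" for x
    by (rule continuous_on_vector_derivative) (rule P_deriv[OF that])
  \<comment> \<open>The weight is chosen so that \<open>\<integral> L W\<close> from \<open>t0\<close> to \<open>s\<close> is at most \<open>W s / 2\<close>. The two sides of \<open>t0\<close> need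
    different primitives of \<open>W\<close>.\<close>
  have contr: "norm (P x s - P y s) \<le> A / 2 * W s"
    if x: "continuous_on {a..b} x" and y: "continuous_on {a..b} y" and "A \<ge> 0"
      and le: "\<And>s. s \<in> {a..b} \<Longrightarrow> norm (x s - y s) \<le> A * W s" and s: "s \<in> {a..b}" for x y A s
  proof -
    define G where "G r = P x r - P y r" for r
    have Gt0: "G t0 = 0"
      by (simp add: G_def P_def)
    have G_cont: "continuous_on {a..b} G"
      unfolding G_def by (intro continuous_intros P_cont x y)
    have G_deriv: "(G has_vector_derivative f r (x r) - f r (y r)) (at r)" if "a < r" "r < b" for r
    proof -
      have "(G has_vector_derivative f r (x r) - f r (y r)) (at r within {a..b})"
        unfolding G_def by (intro has_vector_derivative_diff P_deriv x y) (use that in auto)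
      then show ?thesis
        using that by (simp add: at_within_Icc_at)
    qed
    have bnd: "norm (f r (x r) - f r (y r)) \<le> L * (A * W r)" if "r \<in> {a..b}" for r
      by (rule order_trans[OF Lip[OF that]]) (use le[OF that] \<open>L > 0\<close> in auto)
    consider "s = t0" | "t0 < s" | "s < t0" by linarith
    then have "norm (G s) \<le> A / 2 * W s"
    proof cases
      case 1
      then show ?thesis using Gt0 \<open>A \<ge> 0\<close> W1[of s] by simp
    next
      case 2
      have "norm (G s - G t0) \<le> A / 2 * exp (2 * L * (s - t0)) - A / 2 * exp (2 * L * (t0 - t0))"
      proof (rule differentiable_bound_general[where
            f' = "\<lambda>r. f r (x r) - f r (y r)" and \<phi>' = "\<lambda>r. L * (A * exp (2 * L * (r - t0)))"])
        show "continuous_on {t0..s} G"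
          using G_cont s t0 by (auto intro: continuous_on_subset)
        show "(G has_vector_derivative f r (x r) - f r (y r)) (at r)" if "t0 < r" "r < s" for r
          using that s t0 by (intro G_deriv) auto
        show "norm (f r (x r) - f r (y r)) \<le> L * (A * exp (2 * L * (r - t0)))" if "t0 < r" "r < s" for r
          using bnd[of r] that s t0 by (simp add: W_def)
      qed (use 2 in \<open>auto intro!: continuous_intros derivative_eq_intros simp: has_real_derivative_iff_has_vector_derivative[symmetric]\<close>)
      also have "\<dots> \<le> A / 2 * W s"
        using 2 \<open>A \<ge> 0\<close> by (simp add: W_def)
      finally show ?thesis by (simp add: Gt0)
    next
      case 3
      have "norm (G t0 - G s) \<le> - A / 2 * exp (2 * L * (t0 - t0)) - (- A / 2 * exp (2 * L * (t0 - s)))"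
      proof (rule differentiable_bound_general[where
            f' = "\<lambda>r. f r (x r) - f r (y r)" and \<phi>' = "\<lambda>r. L * (A * exp (2 * L * (t0 - r)))"])
        show "continuous_on {s..t0} G"
          using G_cont s t0 by (auto intro: continuous_on_subset)
        show "(G has_vector_derivative f r (x r) - f r (y r)) (at r)" if "s < r" "r < t0" for r
          using that s t0 by (intro G_deriv) auto
        show "norm (f r (x r) - f r (y r)) \<le> L * (A * exp (2 * L * (t0 - r)))" if "s < r" "r < t0" for r
          using bnd[of r] that s t0 by (simp add: W_def)
      qed (use 3 in \<open>auto intro!: continuous_intros derivative_eq_intros simp: has_real_derivative_iff_has_vector_derivative[symmetric]\<close>)
      also have "\<dots> \<le> A / 2 * W s"
        using 3 \<open>A \<ge> 0\<close> by (simp add: W_def)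
      finally show ?thesis by (simp add: Gt0)
    qed
    then show ?thesis by (simp add: G_def)
  qed
  define xs where "xs k = (P ^^ k) (\<lambda>_. x0)" for k
  have xs_Suc: "xs (Suc k) = P (xs k)" for k
    by (simp add: xs_def)
  have xs_cont: "continuous_on {a..b} (xs k)" for k
    by (induction k) (simp_all add: xs_def P_cont)
  have "bounded ((\<lambda>s. xs 1 s - xs 0 s) ` {a..b})"
    by (intro compact_imp_bounded compact_continuous_image continuous_intros xs_cont) auto
  then obtain A where A: "A > 0" "\<And>s. s \<in> {a..b} \<Longrightarrow> norm (xs 1 s - xs 0 s) \<le> A"
    by (auto simp: bounded_pos)
  have diff: "norm (xs (Suc k) s - xs k s) \<le> A * (1/2) ^ k * W s" if "s \<in> {a..b}" for k s
    using that
  proof (induction k arbitrary: s)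
    case 0
    have "norm (xs 1 s - xs 0 s) \<le> A * 1" using A(2)[OF 0] by simp
    also have "\<dots> \<le> A * W s" using W1[of s] A(1) by (intro mult_left_mono) auto
    finally show ?case by simp
  next
    case (Suc k)
    have "norm (P (xs (Suc k)) s - P (xs k) s) \<le> A * (1/2) ^ k / 2 * W s"
      by (rule contr[OF xs_cont xs_cont]) (use A(1) Suc in auto)
    then show ?case by (simp add: xs_Suc)
  qed
  define Wm where "Wm = exp (2 * L * (b - a))"
  have Wm: "W s \<le> Wm" if "s \<in> {a..b}" for s
    using that t0 \<open>L > 0\<close> by (auto simp: W_def Wm_def)
  have "uniform_limit {a..b} (\<lambda>n s. \<Sum>i<n. xs (Suc i) s - xs i s) (\<lambda>s. \<Sum>i. xs (Suc i) s - xs i s) sequentially"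
  proof (rule Weierstrass_m_test)
    show "norm (xs (Suc k) s - xs k s) \<le> A * Wm * (1/2) ^ k" if "s \<in> {a..b}" for k s
    proof -
      have "A * (1/2) ^ k * W s \<le> A * (1/2) ^ k * Wm"
        using Wm[OF that] A(1) by (intro mult_left_mono) auto
      then show ?thesis using diff[OF that, of k] by (simp add: mult_ac)
    qed
  qed (auto intro!: summable_mult summable_geometric)
  moreover have "(\<Sum>i<n. xs (Suc i) s - xs i s) = xs n s - x0" for n s
    using sum_lessThan_telescope[of "\<lambda>i. xs i s" n] by (simp add: xs_def)
  ultimately have lim_sum: "uniform_limit {a..b} (\<lambda>n s. xs n s - x0) (\<lambda>s. \<Sum>i. xs (Suc i) s - xs i s) sequentially"
    by simp
  define x where "x s = x0 + (\<Sum>i. xs (Suc i) s - xs i s)" for s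
  have lim: "uniform_limit {a..b} xs x sequentially"
    using uniform_limit_add[OF uniform_limit_const[where c="\<lambda>_. x0"] lim_sum] by (simp add: x_def[abs_def])
  have x_cont: "continuous_on {a..b} x"
    by (rule uniform_limit_theorem[OF _ lim]) (auto simp: xs_cont)
  \<comment> \<open>Both \<open>x\<close> and \<open>P x\<close> are limits of the iterates, the latter because \<open>P\<close> contracts.\<close>
  have fix_P: "x s = P x s" if s: "s \<in> {a..b}" for s
  proof -
    have "(\<lambda>n. xs (Suc n) s) \<longlonglongrightarrow> P x s"
    proof (rule metric_LIMSEQ_I)
      fix e :: real assume "e > 0"
      then have "e / Wm > 0" by (simp add: Wm_def)
      from uniform_limitD[OF lim this] obtain N where
        N: "\<And>n r. n \<ge> N \<Longrightarrow> r \<in> {a..b} \<Longrightarrow> dist (xs n r) (x r) < e / Wm"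
        unfolding eventually_sequentially by metis
      have "dist (xs (Suc n) s) (P x s) < e" if "n \<ge> N" for n
      proof -
        have "norm (P (xs n) s - P x s) \<le> (e / Wm) / 2 * W s"
        proof (rule contr[OF xs_cont x_cont _ _ s])
          show "norm (xs n r - x r) \<le> e / Wm * W r" if "r \<in> {a..b}" for r
          proof -
            have "e / Wm * 1 \<le> e / Wm * W r"
              using W1[of r] \<open>e / Wm > 0\<close> by (intro mult_left_mono) auto
            then show ?thesis
              using N[OF \<open>n \<ge> N\<close> that] by (simp add: dist_norm)
          qed
        qed (use \<open>e / Wm > 0\<close> in simp)
        also have "\<dots> \<le> (e / Wm) / 2 * Wm"
          using Wm[OF s] \<open>e / Wm > 0\<close> by (intro mult_left_mono) auto
        also have "\<dots> < e"
          using \<open>e > 0\<close> by (simp add: Wm_def)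
        finally show ?thesis by (simp add: xs_Suc dist_norm)
      qed
      then show "\<exists>N. \<forall>n\<ge>N. dist (xs (Suc n) s) (P x s) < e" by blast
    qed
    moreover have "(\<lambda>n. xs (Suc n) s) \<longlonglongrightarrow> x s"
      using tendsto_uniform_limitI[OF lim s] by (rule LIMSEQ_Suc)
    ultimately show ?thesis
      by (rule LIMSEQ_unique[rotated])
  qed
  have "x t0 = x0"
    using fix_P[OF t0] by (simp add: P_def)
  moreover have "(x has_vector_derivative f s (x s)) (at s within {a..b})" if "s \<in> {a..b}" for s
    using P_deriv[OF x_cont that] fix_P by (auto intro: has_vector_derivative_transform[OF that])
  ultimately show ?thesis by blast
qed

text \<open>
  The Loewner vector field is Lipschitz with constant \<open>2 / y\<^sup>2\<close> at height at least \<open>y\<close> above the real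
  axis.
\<close>

lemma norm_2_divide_diff_le:
  fixes p q :: complex
  assumes "0 < y" "y \<le> Im p" "y \<le> Im q"
  shows "norm (2 / p - 2 / q) \<le> 2 / y\<^sup>2 * norm (p - q)"
proof -
  have ge: "y \<le> norm p" "y \<le> norm q"
    using assms abs_Im_le_cmod[of p] abs_Im_le_cmod[of q] by linarith+
  then have "y\<^sup>2 \<le> norm p * norm q"
    using \<open>0 < y\<close> by (auto simp: power2_eq_square intro: mult_mono)
  moreover have "norm (2 / p - 2 / q) = 2 * norm (p - q) / (norm p * norm q)"
  proof -
    have "2 / p - 2 / q = 2 * (q - p) / (p * q)"
      using assms by (subst diff_frac_eq) (auto simp: algebra_simps)
    then show ?thesis
      by (simp only: norm_divide norm_mult norm_minus_commute[of q p] norm_numeral)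
  qed
  moreover have "0 < y\<^sup>2" using \<open>0 < y\<close> by simp
  ultimately show ?thesis
    using frac_le[of "2 * norm (p - q)" "2 * norm (p - q)" "y\<^sup>2" "norm p * norm q"] by simp
qed

text \<open>
  Running the equation backward in time increases the imaginary part, so it never leaves the region
  where the vector field is Lipschitz. Replacing \<open>w\<close> by the point \<open>clip w\<close> of height at least \<open>y/2\<close> in
  the vector field makes it globally Lipschitz without changing anything before time \<open>t\<close>; since the
  speed is at most \<open>4/y\<close>, nothing is changed either for a short time after \<open>t\<close>. This short
  extension is what shows that \<open>t\<close> is strictly smaller than the lifetime.
\<close>

lemma loewner_solution_through:
  assumes \<xi>: "continuous_on {0..} \<xi>" and "0 \<le> t" and "0 < y" and z: "y \<le> Im z"
  shows "\<exists>u T. ereal t < T \<and> loewner_solution \<xi> (u 0) T u \<and> u t = z \<and> (\<forall>s\<in>{0..t}. y \<le> Im (u s))"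
proof -
  define clip where "clip w = Complex (Re w) (max (Im w) (y/2))" for w
  have clip_eq: "clip w = w" if "y/2 \<le> Im w" for w
    using that by (simp add: clip_def complex_eq_iff)
  have clip_Im: "y/2 \<le> Im (clip w)" for w
    by (simp add: clip_def)
  have clip_Lip: "norm (clip v - clip w) \<le> norm (v - w)" for v w
  proof -
    have "\<bar>max (Im v) (y/2) - max (Im w) (y/2)\<bar> \<le> \<bar>Im v - Im w\<bar>"
      by (auto simp: max_def)
    then have "(max (Im v) (y/2) - max (Im w) (y/2))\<^sup>2 \<le> (Im v - Im w)\<^sup>2"
      by (simp add: abs_le_square_iff)
    then show ?thesis
      by (simp add: cmod_def clip_def)
  qed
  have clip_cont: "continuous_on S clip" for S
    unfolding clip_def Complex_eq by (intro continuous_intros)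
  define V where "V s w = 2 / (clip w - of_real (\<xi> s))" for s w
  have "\<exists>x. x t = z \<and> (\<forall>s\<in>{0..t+1}. (x has_vector_derivative V s (x s)) (at s within {0..t+1}))"
  proof (rule picard_lindelof_global)
    show "continuous_on {0..t+1} (\<lambda>s. V s (x s))" if "continuous_on {0..t+1} x" for x
      unfolding V_def
    proof (intro continuous_intros continuous_on_subset[OF \<xi>])
      show "continuous_on {0..t+1} (\<lambda>s. clip (x s))"
        by (rule continuous_on_compose2[OF clip_cont that]) auto
      show "\<forall>s\<in>{0..t+1}. clip (x s) - of_real (\<xi> s) \<noteq> 0"
      proof (intro ballI notI)
        fix s assume "clip (x s) - of_real (\<xi> s) = 0"
        then have "Im (clip (x s)) = 0" by (simp add: complex_eq_iff)
        then show False using clip_Im[of "x s"] \<open>0 < y\<close> by simp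
      qed
    qed auto
    show "norm (V s v - V s w) \<le> (2 / (y/2)\<^sup>2) * norm (v - w)" for s v w
    proof -
      have "norm (V s v - V s w)
          \<le> (2 / (y/2)\<^sup>2) * norm (clip v - of_real (\<xi> s) - (clip w - of_real (\<xi> s)))"
        unfolding V_def by (rule norm_2_divide_diff_le) (use clip_Im \<open>0 < y\<close> in auto)
      also have "\<dots> \<le> (2 / (y/2)\<^sup>2) * norm (v - w)"
        using clip_Lip by (intro mult_left_mono) auto
      finally show ?thesis .
    qed
  qed (use \<open>0 \<le> t\<close> \<open>0 < y\<close> in auto)
  then obtain x where x: "x t = z"
    "\<And>s. s \<in> {0..t+1} \<Longrightarrow> (x has_vector_derivative V s (x s)) (at s within {0..t+1})"
    by blast
  have x_cont: "continuous_on {0..t+1} x"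
    by (rule continuous_on_vector_derivative) (rule x(2))
  have x_at: "(x has_vector_derivative V s (x s)) (at s)" if "0 < s" "s < t + 1" for s
    using x(2)[of s] that by (simp add: at_within_Icc_at)
  have V_Im: "Im (V s w) \<le> 0" for s w
  proof -
    have "0 \<le> Im (clip w)" using clip_Im[of w] \<open>0 < y\<close> by linarith
    then show ?thesis
      unfolding V_def by (simp add: Im_divide divide_nonneg_nonneg)
  qed
  have V_norm: "norm (V s w) \<le> 4 / y" for s w
  proof -
    have "y / 2 \<le> norm (clip w - of_real (\<xi> s))"
      using clip_Im[of w] abs_Im_le_cmod[of "clip w - of_real (\<xi> s)"] by simp
    then have "2 / norm (clip w - of_real (\<xi> s)) \<le> 2 / (y / 2)"
      using \<open>0 < y\<close> by (intro frac_le) auto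
    then show ?thesis
      by (simp add: V_def norm_divide)
  qed
  have before: "y \<le> Im (x s)" if "s \<in> {0..t}" for s
  proof -
    have "Im (x t) \<le> Im (x s)"
    proof (rule DERIV_nonpos_imp_decreasing_open[of s t "\<lambda>s. Im (x s)"])
      show "continuous_on {s..t} (\<lambda>s. Im (x s))"
        by (intro continuous_intros continuous_on_subset[OF x_cont]) (use that in auto)
      fix r assume "s < r" "r < t"
      then have "((\<lambda>s. Im (x s)) has_vector_derivative Im (V r (x r))) (at r)"
        using x_at[of r] that by (auto intro: bounded_linear.has_vector_derivative[OF bounded_linear_Im])
      then show "\<exists>d. ((\<lambda>s. Im (x s)) has_real_derivative d) (at r) \<and> d \<le> 0"
        using V_Im by (auto simp: has_real_derivative_iff_has_vector_derivative)
    qed (use that in auto)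
    then show ?thesis using x(1) z by simp
  qed
  define \<eta> where "\<eta> = min 1 (y\<^sup>2 / 8)"
  have "0 < \<eta>" using \<open>0 < y\<close> by (simp add: \<eta>_def)
  have after: "y / 2 \<le> Im (x s)" if s: "t < s" "s \<le> t + \<eta>" for s
  proof -
    have "norm (x s - x t) \<le> 4 / y * s - 4 / y * t"
    proof (rule differentiable_bound_general[where f' = "\<lambda>r. V r (x r)" and \<phi>' = "\<lambda>_. 4 / y"])
      show "continuous_on {t..s} x"
        by (rule continuous_on_subset[OF x_cont]) (use s \<open>0 \<le> t\<close> in \<open>auto simp: \<eta>_def\<close>)
      show "(x has_vector_derivative V r (x r)) (at r)" if "t < r" "r < s" for r
        using that s \<open>0 \<le> t\<close> by (intro x_at) (auto simp: \<eta>_def)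
      show "((*) (4 / y) has_vector_derivative 4 / y) (at r)" for r
        by (auto intro!: derivative_eq_intros simp: has_real_derivative_iff_has_vector_derivative[symmetric])
    qed (use s V_norm \<open>0 < y\<close> in \<open>auto intro!: continuous_intros\<close>)
    also have "\<dots> = 4 / y * (s - t)" by (simp only: right_diff_distrib)
    also have "\<dots> \<le> 4 / y * (y\<^sup>2 / 8)"
      using s \<open>0 < y\<close> by (intro mult_left_mono) (auto simp: \<eta>_def)
    also have "\<dots> = y / 2" using \<open>0 < y\<close> by (simp add: power2_eq_square)
    finally have "norm (x s - x t) \<le> y / 2" .
    then have "\<bar>Im (x s - x t)\<bar> \<le> y / 2"
      using abs_Im_le_cmod[of "x s - x t"] by linarith
    then have "Im (x t) - Im (x s) \<le> y / 2" unfolding minus_complex.simps by linarith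
    then show ?thesis using x(1) z by simp
  qed
  have "loewner_solution \<xi> (x 0) (ereal (t + \<eta>)) x"
    unfolding loewner_solution_def
  proof (intro conjI allI impI)
    fix s assume s: "0 \<le> s" "ereal s < ereal (t + \<eta>)"
    then have Im: "y / 2 \<le> Im (x s)"
      using before[of s] after[of s] \<open>0 < y\<close> by (cases "s \<le> t") auto
    then show "x s \<noteq> of_real (\<xi> s)"
      using \<open>0 < y\<close> by auto
    have "at s within {0..t+1} = at s within {0..}"
      using s by (intro at_within_nhd[of s "{..<t+1}"]) (auto simp: \<eta>_def)
    then show "(x has_vector_derivative 2 / (x s - of_real (\<xi> s))) (at s within {0..})"
      using x(2)[of s] s clip_eq[OF Im] by (simp add: V_def \<eta>_def)
  qed simp
  then show ?thesis
    using x(1) before \<open>0 < \<eta>\<close> by (intro exI[of _ x] exI[of _ "ereal (t + \<eta>)"]) auto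
qed

section \<open>The Euler scheme for the reverse flow\<close>

text \<open>
  The reverse flow, seen from its driving point, satisfies \<open>dZ = - 2/Z ds + dJ\<close>. This is its explicit
  Euler scheme with step \<open>h\<close> and driving increments \<open>J 0, J 1, \<dots>\<close>. For \<open>h \<ge> 0\<close> each step is
  holomorphic on the upper half-plane and does not decrease the imaginary part.
\<close>

primrec euler_loewner :: "real \<Rightarrow> (nat \<Rightarrow> real) \<Rightarrow> nat \<Rightarrow> complex \<Rightarrow> complex" where
  "euler_loewner h J 0 z = z"
| "euler_loewner h J (Suc k) z =
     euler_loewner h J k z - of_real (2 * h) / euler_loewner h J k z + of_real (J k)"

primrec euler_deriv :: "real \<Rightarrow> (nat \<Rightarrow> real) \<Rightarrow> nat \<Rightarrow> complex \<Rightarrow> complex" where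
  "euler_deriv h J 0 z = 1"
| "euler_deriv h J (Suc k) z =
     euler_deriv h J k z * (1 + of_real (2 * h) / (euler_loewner h J k z)\<^sup>2)"

lemma Im_euler_step:
  "Im (c - of_real (2 * h) / c + of_real j) = Im c * (1 + 2 * h / (cmod c)\<^sup>2)"
  by (simp add: Im_divide cmod_power2 algebra_simps)

lemma Im_euler_loewner_mono:
  assumes "0 < Im z" "0 \<le> h"
  shows "Im z \<le> Im (euler_loewner h J k z)"
proof (induction k)
  case (Suc k)
  have "Im (euler_loewner h J k z) * 1 \<le> Im (euler_loewner h J k z) *
      (1 + 2 * h / (cmod (euler_loewner h J k z))\<^sup>2)"
    using assms Suc by (intro mult_left_mono) auto
  then show ?case
    using Suc by (simp only: euler_loewner.simps Im_euler_step)
qed simp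

lemma has_field_derivative_euler_loewner:
  assumes "0 < Im z" "0 \<le> h"
  shows "(euler_loewner h J k has_field_derivative euler_deriv h J k z) (at z)"
proof (induction k)
  case (Suc k)
  have "euler_loewner h J k z \<noteq> 0"
    using Im_euler_loewner_mono[OF assms, of J k] assms(1) by auto
  then have "((\<lambda>z. euler_loewner h J k z - of_real (2 * h) / euler_loewner h J k z + of_real (J k))
      has_field_derivative euler_deriv h J k z - - (of_real (2 * h) * euler_deriv h J k z) /
        (euler_loewner h J k z)\<^sup>2) (at z)"
    using Suc by (auto intro!: derivative_eq_intros simp: power2_eq_square)
  then show ?case
    by (simp add: algebra_simps)
qed (auto intro!: derivative_eq_intros)

text \<open>
  The standard error estimate for the Euler scheme, run backward from time \<open>t\<close>. The error made in one
  step is \<open>h\<close> times the oscillation of the vector field along the solution, which is controlled by the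
  speed bound \<open>2/y\<close> and the oscillation \<open>\<omega>\<close> of \<open>\<xi>\<close>; the Lipschitz constant \<open>2/y\<^sup>2\<close> propagates it. The
  bound depends on the starting point only through the height \<open>y\<close>, which makes the convergence of
  the scheme uniform on half-planes.
\<close>

lemma euler_loewner_error:
  fixes t h :: real
  assumes u: "loewner_solution \<xi> z0 T u" and t: "0 \<le> t" "ereal t < T"
    and y: "0 < y" and Im_u: "\<And>s. s \<in> {0..t} \<Longrightarrow> y \<le> Im (u s)"
    and h: "0 \<le> h" "real n * h = t"
    and osc: "\<And>r s. r \<in> {0..t} \<Longrightarrow> s \<in> {0..t} \<Longrightarrow> \<bar>r - s\<bar> \<le> h \<Longrightarrow> \<bar>\<xi> r - \<xi> s\<bar> \<le> \<omega>"
    and J: "\<And>k. k < n \<Longrightarrow> J k = \<xi> (t - k * h) - \<xi> (t - Suc k * h)"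
  shows "norm (euler_loewner h J n (u t - of_real (\<xi> t)) - (u 0 - of_real (\<xi> 0)))
    \<le> t * (2 / y\<^sup>2 * (2 * h / y + \<omega>)) * exp (2 * t / y\<^sup>2)"
proof -
  define z where "z = u t - of_real (\<xi> t)"
  define m where "m = 2 / y\<^sup>2 * (2 * h / y + \<omega>)"
  define K where "K = 2 / y\<^sup>2"
  have "0 \<le> K" by (simp add: K_def)
  have "0 \<le> \<omega>" using osc[of 0 0] t h by auto
  then have "0 \<le> m" using y h by (simp add: m_def)
  have u_deriv: "(u has_vector_derivative 2 / (u s - of_real (\<xi> s))) (at s within {0..t})"
    if "s \<in> {0..t}" for s
  proof -
    have "ereal s < T" using that t(2) by (auto intro: le_less_trans[of "ereal s" "ereal t"])
    then show ?thesis
      using u that unfolding loewner_solution_def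
      by (auto intro: has_vector_derivative_within_subset[where S="{0..}"])
  qed
  have u_at: "(u has_vector_derivative 2 / (u s - of_real (\<xi> s))) (at s)" if "0 < s" "s < t" for s
    using u_deriv[of s] that by (simp add: at_within_Icc_at)
  have u_cont: "continuous_on {0..t} u"
    by (rule continuous_on_vector_derivative) (rule u_deriv)
  have speed: "norm (2 / (u s - of_real (\<xi> s))) \<le> 2 / y" if "s \<in> {0..t}" for s
  proof -
    have "y \<le> norm (u s - of_real (\<xi> s))"
      using Im_u[OF that] abs_Im_le_cmod[of "u s - of_real (\<xi> s)"] by simp
    then show ?thesis
      using y frac_le[of 2 2 y "norm (u s - of_real (\<xi> s))"] by (simp add: norm_divide)
  qed
  have u_Lip: "norm (u b - u a) \<le> 2 / y * (b - a)" if "0 \<le> a" "a < b" "b \<le> t" for a b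
  proof -
    have "norm (u b - u a) \<le> 2 / y * b - 2 / y * a"
    proof (rule differentiable_bound_general[where f' = "\<lambda>s. 2 / (u s - of_real (\<xi> s))" and \<phi>' = "\<lambda>_. 2 / y"])
      show "continuous_on {a..b} u"
        by (rule continuous_on_subset[OF u_cont]) (use that in auto)
      show "((*) (2 / y) has_vector_derivative 2 / y) (at r)" for r
        by (auto intro!: derivative_eq_intros simp: has_real_derivative_iff_has_vector_derivative[symmetric])
    qed (use that u_at speed y in \<open>auto intro!: continuous_intros\<close>)
    then show ?thesis by (simp only: right_diff_distrib)
  qed
  \<comment> \<open>The local error, obtained by comparing \<open>u\<close> with its tangent at the right end point.\<close>
  have trunc: "norm (u b - u a - of_real (b - a) * (2 / (u b - of_real (\<xi> b)))) \<le> m * (b - a)"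
    if ab: "0 \<le> a" "a < b" "b \<le> t" "b - a \<le> h" for a b
  proof -
    let ?v = "2 / (u b - of_real (\<xi> b))"
    have "norm ((u b - of_real b * ?v) - (u a - of_real a * ?v)) \<le> m * b - m * a"
    proof (rule differentiable_bound_general[where
          f' = "\<lambda>s. 2 / (u s - of_real (\<xi> s)) - ?v" and \<phi>' = "\<lambda>_. m"])
      show "continuous_on {a..b} (\<lambda>s. u s - of_real s * ?v)"
        by (intro continuous_intros continuous_on_subset[OF u_cont]) (use ab in auto)
      show "((*) m has_vector_derivative m) (at r)" for r
        by (auto intro!: derivative_eq_intros simp: has_real_derivative_iff_has_vector_derivative[symmetric])
      fix r assume r: "a < r" "r < b"
      have "((\<lambda>s. of_real s * ?v) has_vector_derivative of_real 1 * ?v) (at r)"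
        by (intro has_vector_derivative_mult_left has_vector_derivative_of_real) (auto intro!: derivative_eq_intros)
      then show "((\<lambda>s. u s - of_real s * ?v) has_vector_derivative 2 / (u r - of_real (\<xi> r)) - ?v) (at r)"
        using u_at[of r] r ab by (auto intro!: has_vector_derivative_diff)
      have "norm (2 / (u r - of_real (\<xi> r)) - ?v)
          \<le> 2 / y\<^sup>2 * norm (u r - of_real (\<xi> r) - (u b - of_real (\<xi> b)))"
        by (rule norm_2_divide_diff_le) (use r ab Im_u y in auto)
      also have "\<dots> \<le> 2 / y\<^sup>2 * (2 * h / y + \<omega>)"
      proof (intro mult_left_mono)
        have "norm (u r - of_real (\<xi> r) - (u b - of_real (\<xi> b)))
            = norm ((u r - u b) + of_real (\<xi> b - \<xi> r))"
          by (simp add: algebra_simps)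
        also have "\<dots> \<le> norm (u b - u r) + \<bar>\<xi> b - \<xi> r\<bar>"
          using norm_triangle_ineq[of "u r - u b" "of_real (\<xi> b - \<xi> r)"]
          by (simp only: norm_of_real norm_minus_commute[of "u r"])
        also have "norm (u b - u r) \<le> 2 / y * (b - r)"
          using u_Lip[of r b] r ab by simp
        also have "\<dots> \<le> 2 / y * h" using r ab y by (intro mult_left_mono) auto
        also have "\<bar>\<xi> b - \<xi> r\<bar> \<le> \<omega>" using osc[of b r] r ab by auto
        finally show "norm (u r - of_real (\<xi> r) - (u b - of_real (\<xi> b))) \<le> 2 * h / y + \<omega>"
          by simp
      qed simp
      finally show "norm (2 / (u r - of_real (\<xi> r)) - ?v) \<le> m"
        by (simp add: m_def)
    qed (use ab in \<open>auto intro!: continuous_intros\<close>)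
    then show ?thesis by (simp add: algebra_simps diff_divide_distrib)
  qed
  define s where "s k = t - real k * h" for k
  define c where "c k = u (s k) - of_real (\<xi> (s k))" for k
  have s_in: "s k \<in> {0..t}" if "k \<le> n" for k
    using that h mult_right_mono[of "real k" "real n" h] by (auto simp: s_def)
  have Im_z: "y \<le> Im z" using Im_u[of t] t by (simp add: z_def)
  have Im_e: "y \<le> Im (euler_loewner h J k z)" for k
    using Im_euler_loewner_mono[of z h J k] Im_z y h by simp
  \<comment> \<open>Discrete Gronwall inequality.\<close>
  have "norm (euler_loewner h J k z - c k) \<le> real k * (h * m) * (1 + K * h) ^ k" if "k \<le> n" for k
    using that
  proof (induction k)
    case 0
    then show ?case by (simp add: c_def z_def s_def)
  next
    case (Suc k)
    let ?e = "euler_loewner h J k z"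
    have step: "norm (u (s (Suc k)) - u (s k) + of_real h * (2 / c k)) \<le> m * h"
    proof (cases "h = 0")
      case False
      then have "norm (u (s k) - u (s (Suc k)) - of_real (s k - s (Suc k)) * (2 / c k))
          \<le> m * (s k - s (Suc k))"
        unfolding c_def using s_in[of "Suc k"] s_in[of k] Suc.prems h
        by (intro trunc) (auto simp: s_def algebra_simps)
      moreover have "s k - s (Suc k) = h" by (simp add: s_def algebra_simps)
      ultimately show ?thesis
        using norm_minus_commute[of "u (s k) - u (s (Suc k))" "of_real h * (2 / c k)"]
        by (simp add: algebra_simps)
    qed (simp add: s_def)
    have "euler_loewner h J (Suc k) z - c (Suc k)
        = (?e - c k) - of_real h * (2 / ?e - 2 / c k) - (u (s (Suc k)) - u (s k) + of_real h * (2 / c k))"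
      using J[of k] Suc.prems by (simp add: c_def s_def) (simp add: algebra_simps)
    also have "norm \<dots> \<le> norm (?e - c k) + norm (of_real h * (2 / ?e - 2 / c k))
        + norm (u (s (Suc k)) - u (s k) + of_real h * (2 / c k))"
      by (intro order_trans[OF norm_triangle_ineq4] add_mono order_refl)
    also have "norm (of_real h * (2 / ?e - 2 / c k)) \<le> h * (K * norm (?e - c k))"
    proof -
      have "norm (2 / ?e - 2 / c k) \<le> K * norm (?e - c k)"
        unfolding K_def
        by (rule norm_2_divide_diff_le[OF y Im_e]) (use Im_u[OF s_in] Suc.prems in \<open>auto simp: c_def\<close>)
      then show ?thesis
        using h by (simp only: norm_mult norm_of_real abs_of_nonneg mult_left_mono)
    qed
    also have "norm (?e - c k) + h * (K * norm (?e - c k)) + norm (u (s (Suc k)) - u (s k) + of_real h * (2 / c k))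
        \<le> (1 + K * h) * norm (?e - c k) + m * h"
      using step by (simp add: algebra_simps)
    also have "\<dots> \<le> (1 + K * h) * (real k * (h * m) * (1 + K * h) ^ k) + m * h * (1 + K * h) ^ Suc k"
    proof (intro add_mono mult_left_mono)
      have "1 \<le> (1 + K * h) ^ Suc k"
        using \<open>0 \<le> K\<close> h by (intro one_le_power) auto
      then show "m * h \<le> m * h * (1 + K * h) ^ Suc k"
        using \<open>0 \<le> m\<close> h mult_left_mono[of 1 "(1 + K * h) ^ Suc k" "m * h"] by simp
    qed (use Suc \<open>0 \<le> K\<close> h in auto)
    also have "\<dots> = real (Suc k) * (h * m) * (1 + K * h) ^ Suc k"
      by (simp add: algebra_simps)
    finally show ?case by simp
  qed
  from this[of n] have "norm (euler_loewner h J n z - c n) \<le> t * m * (1 + K * h) ^ n"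
    using h by (simp add: mult.assoc[symmetric])
  also have "\<dots> \<le> t * m * exp (2 * t / y\<^sup>2)"
  proof (intro mult_left_mono)
    have "(1 + K * h) ^ n \<le> exp (K * h) ^ n"
      using \<open>0 \<le> K\<close> h by (intro power_mono exp_ge_add_one_self_aux exp_ge_add_one_self) auto
    also have "\<dots> = exp (2 * t / y\<^sup>2)"
      using h by (simp add: K_def exp_of_nat_mult[symmetric] mult.left_commute)
    finally show "(1 + K * h) ^ n \<le> exp (2 * t / y\<^sup>2)" .
  qed (use t \<open>0 \<le> m\<close> in auto)
  finally show ?thesis
    using h by (simp add: z_def m_def c_def s_def)
qed

lemma uniform_limit_euler_loewner:
  assumes \<xi>: "continuous_on {0..} \<xi>" and t: "0 \<le> t" and y: "0 < y"
  shows "uniform_limit {z. y \<le> Im z}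
    (\<lambda>n. euler_loewner (t / Suc n) (\<lambda>k. \<xi> (t - k * (t / Suc n)) - \<xi> (t - Suc k * (t / Suc n))) (Suc n))
    (\<lambda>z. loewner_fhat \<xi> t z - of_real (\<xi> 0)) sequentially"
proof (rule uniform_limitI)
  fix e :: real assume "e > 0"
  define A where "A = t * (2 / y\<^sup>2) * exp (2 * t / y\<^sup>2)"
  have "0 \<le> A" using t by (simp add: A_def)
  define \<omega> where "\<omega> = e / (2 * (A + 1))"
  have "0 < \<omega>" "A * \<omega> < e"
    using \<open>0 \<le> A\<close> \<open>0 < e\<close> by (auto simp: \<omega>_def field_simps intro!: add_nonneg_pos)
  have "uniformly_continuous_on {0..t} \<xi>"
    by (intro compact_uniformly_continuous continuous_on_subset[OF \<xi>]) auto
  then obtain d where d: "d > 0" "\<And>r s. r \<in> {0..t} \<Longrightarrow> s \<in> {0..t} \<Longrightarrow> dist r s < d \<Longrightarrow> dist (\<xi> r) (\<xi> s) < \<omega>"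
    unfolding uniformly_continuous_on_def using \<open>0 < \<omega>\<close> by metis
  have h_lim: "(\<lambda>n. t / Suc n) \<longlonglongrightarrow> 0"
    using LIMSEQ_Suc[OF lim_const_over_n[of t]] by simp
  have "(\<lambda>n. A * (2 * (t / Suc n) / y + \<omega>)) \<longlonglongrightarrow> A * (2 * 0 / y + \<omega>)"
    by (intro tendsto_intros h_lim) (use y in auto)
  then have "\<forall>\<^sub>F n in sequentially. A * (2 * (t / Suc n) / y + \<omega>) < e"
    by (rule order_tendstoD) (use \<open>A * \<omega> < e\<close> in simp)
  moreover have "\<forall>\<^sub>F n in sequentially. t / Suc n < d"
    using h_lim d(1) by (rule order_tendstoD)
  ultimately show "\<forall>\<^sub>F n in sequentially. \<forall>z\<in>{z. y \<le> Im z}.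
      dist (euler_loewner (t / Suc n) (\<lambda>k. \<xi> (t - k * (t / Suc n)) - \<xi> (t - Suc k * (t / Suc n))) (Suc n) z)
        (loewner_fhat \<xi> t z - of_real (\<xi> 0)) < e"
  proof eventually_elim
    case (elim n)
    show ?case
    proof
      fix z assume z: "z \<in> {z. y \<le> Im z}"
      then obtain u T where u: "ereal t < T" "loewner_solution \<xi> (u 0) T u"
          "u t = z + of_real (\<xi> t)" "\<And>s. s \<in> {0..t} \<Longrightarrow> y \<le> Im (u s)"
        using loewner_solution_through[OF \<xi> t y, of "z + of_real (\<xi> t)"] by auto
      have "0 < Im (u 0)" using u(4)[of 0] y t by simp
      then have fhat: "loewner_fhat \<xi> t z = u 0"
        by (rule loewner_fhat_eq[OF \<xi> u(2) t u(1) _ u(3)])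
      have "norm (euler_loewner (t / Suc n) (\<lambda>k. \<xi> (t - k * (t / Suc n)) - \<xi> (t - Suc k * (t / Suc n)))
            (Suc n) (u t - of_real (\<xi> t)) - (u 0 - of_real (\<xi> 0)))
          \<le> t * (2 / y\<^sup>2 * (2 * (t / Suc n) / y + \<omega>)) * exp (2 * t / y\<^sup>2)"
      proof (rule euler_loewner_error[OF u(2) t u(1) y u(4)])
        show "\<bar>\<xi> r - \<xi> s\<bar> \<le> \<omega>" if "r \<in> {0..t}" "s \<in> {0..t}" "\<bar>r - s\<bar> \<le> t / Suc n" for r s
          using d(2)[OF that(1,2)] that(3) elim(2) by (simp add: dist_real_def)
      qed (use t in auto)
      also have "\<dots> = A * (2 * (t / Suc n) / y + \<omega>)"
        by (simp add: A_def)
      also have "\<dots> < e" by (rule elim(1))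
      finally show "dist (euler_loewner (t / Suc n)
          (\<lambda>k. \<xi> (t - k * (t / Suc n)) - \<xi> (t - Suc k * (t / Suc n))) (Suc n) z)
          (loewner_fhat \<xi> t z - of_real (\<xi> 0)) < e"
        by (simp add: fhat u(3) dist_norm)
    qed
  qed
qed

text \<open>
  Uniform convergence of holomorphic functions entails convergence of their derivatives, so that
  differentiability of \<open>loewner_fhat\<close> comes out of the same argument. This is the only link
  between \<open>loewner_fhat\<close> and the discrete scheme that the probabilistic part uses.
\<close>

lemma euler_deriv_tendsto:
  assumes \<xi>: "continuous_on {0..} \<xi>" and t: "0 \<le> t" and z: "0 < Im z"
  shows "(\<lambda>n. euler_deriv (t / Suc n) (\<lambda>k. \<xi> (t - k * (t / Suc n)) - \<xi> (t - Suc k * (t / Suc n))) (Suc n) z)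
    \<longlonglongrightarrow> deriv (loewner_fhat \<xi> t) z"
proof -
  define r where "r = Im z / 2"
  have r: "0 < r" using z by (simp add: r_def)
  have Im: "r \<le> Im w" if "w \<in> cball z r" for w
  proof -
    have "\<bar>Im (z - w)\<bar> \<le> r"
      using that abs_Im_le_cmod[of "z - w"] by (simp add: dist_norm)
    then have "Im z - Im w \<le> r" unfolding minus_complex.simps by linarith
    then show ?thesis by (simp add: r_def)
  qed
  let ?E = "\<lambda>n. euler_loewner (t / Suc n) (\<lambda>k. \<xi> (t - k * (t / Suc n)) - \<xi> (t - Suc k * (t / Suc n))) (Suc n)"
  let ?D = "\<lambda>n. euler_deriv (t / Suc n) (\<lambda>k. \<xi> (t - k * (t / Suc n)) - \<xi> (t - Suc k * (t / Suc n))) (Suc n)"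
  have E: "(?E n has_field_derivative ?D n w) (at w)" if "w \<in> cball z r" for n w
    using Im[OF that] r t by (intro has_field_derivative_euler_loewner) auto
  have lim: "uniform_limit (cball z r) ?E (\<lambda>z. loewner_fhat \<xi> t z - of_real (\<xi> 0)) sequentially"
    by (rule uniform_limit_on_subset[OF uniform_limit_euler_loewner[OF \<xi> t r]]) (use Im in auto)
  have "\<forall>\<^sub>F n in sequentially. continuous_on (cball z r) (?E n) \<and>
      (\<forall>w\<in>ball z r. (?E n has_field_derivative ?D n w) (at w))"
    using E by (intro always_eventually allI conjI ballI)
      (auto intro!: continuous_at_imp_continuous_on DERIV_isCont simp del: euler_loewner.simps euler_deriv.simps)
  from has_complex_derivative_uniform_limit[OF this lim sequentially_bot r]
  obtain g' where g': "\<And>w. w \<in> ball z r \<Longrightarrow>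
      ((\<lambda>z. loewner_fhat \<xi> t z - of_real (\<xi> 0)) has_field_derivative g' w) (at w) \<and> (\<lambda>n. ?D n w) \<longlonglongrightarrow> g' w"
    by blast
  have "((\<lambda>w. (loewner_fhat \<xi> t w - of_real (\<xi> 0)) + of_real (\<xi> 0)) has_field_derivative g' z + 0) (at z)"
    using g'[of z] r by (intro DERIV_add DERIV_const) auto
  then have "deriv (loewner_fhat \<xi> t) z = g' z"
    by (intro DERIV_imp_deriv) simp
  then show ?thesis
    using g'[of z] r by simp
qed

section \<open>Gaussian translations and powers of the norm\<close>

lemma powr_one_plus_taylor_le:
  fixes p :: real
  shows "\<exists>C\<ge>0. \<forall>s. \<bar>s\<bar> \<le> 9/16 \<longrightarrow> (1 + s) powr p \<le> 1 + p * s + p * (p - 1) / 2 * s\<^sup>2 + C * \<bar>s\<bar> ^ 3"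
proof -
  define A where "A = (7/16) powr (p - 3) + (25/16) powr (p - 3)"
  define K where "K = \<bar>p * (p - 1) * (p - 2)\<bar> * A"
  have "0 \<le> A" by (simp add: A_def)
  have "0 \<le> K" by (simp add: K_def A_def)
  define diff where "diff m t = (if m = 0 then (1 + t) powr p
      else if m = 1 then p * (1 + t) powr (p - 1)
      else if m = 2 then p * (p - 1) * (1 + t) powr (p - 2)
      else p * (p - 1) * (p - 2) * (1 + t) powr (p - 3))" for m :: nat and t :: real
  have "(1 + s) powr p \<le> 1 + p * s + p * (p - 1) / 2 * s\<^sup>2 + K * \<bar>s\<bar> ^ 3" if s: "\<bar>s\<bar> \<le> 9/16" for s
  proof (cases "s = 0")
    case False
    have "\<exists>t. (if s < 0 then s < t \<and> t < 0 else 0 < t \<and> t < s) \<and>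
        (1 + s) powr p = (\<Sum>m<3. (diff m 0 / fact m) * (s - 0) ^ m) + (diff 3 t / fact 3) * (s - 0) ^ 3"
    proof (rule Taylor[of 3 diff _ "-9/16" "9/16"])
      show "\<forall>m t. m < 3 \<and> - 9/16 \<le> t \<and> t \<le> 9/16 \<longrightarrow> (diff m has_real_derivative diff (Suc m) t) (at t)"
      proof (intro allI impI)
        fix m :: nat and t :: real assume mt: "m < 3 \<and> - 9/16 \<le> t \<and> t \<le> 9/16"
        then consider "m = 0" | "m = 1" | "m = 2" by linarith
        then show "(diff m has_real_derivative diff (Suc m) t) (at t)"
          by cases (use mt in \<open>auto simp: diff_def[abs_def] intro!: derivative_eq_intros\<close>)
      qed
    qed (use s False in \<open>auto simp: diff_def[abs_def]\<close>)
    then obtain t where t0: "if s < 0 then s < t \<and> t < 0 else 0 < t \<and> t < s" and eq: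
      "(1 + s) powr p = (\<Sum>m<3. (diff m 0 / fact m) * s ^ m) + (diff 3 t / fact 3) * s ^ 3"
      by auto
    have t: "\<bar>t\<bar> \<le> 9/16"
      using t0 s by (auto split: if_splits)
    have "(1 + t) powr (p - 3) \<le> A"
    proof (cases "p \<ge> 3")
      case True
      then have "(1 + t) powr (p - 3) \<le> (25/16) powr (p - 3)"
        using t by (intro powr_mono2) auto
      then show ?thesis by (simp add: A_def add_increasing)
    next
      case False
      then have "(1 + t) powr (p - 3) \<le> (7/16) powr (p - 3)"
        using t by (intro powr_mono2') auto
      then show ?thesis by (simp add: A_def add_increasing2)
    qed
    then have "\<bar>diff 3 t\<bar> \<le> K"
      unfolding diff_def K_def by (auto simp: abs_mult intro!: mult_left_mono)
    then have "\<bar>diff 3 t / fact 3\<bar> \<le> K"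
      using \<open>0 \<le> K\<close> by (simp add: fact_numeral)
    then have "\<bar>diff 3 t / fact 3\<bar> * \<bar>s\<bar> ^ 3 \<le> K * \<bar>s\<bar> ^ 3"
      by (intro mult_right_mono) auto
    then have "(diff 3 t / fact 3) * s ^ 3 \<le> K * \<bar>s\<bar> ^ 3"
      using abs_ge_self[of "(diff 3 t / fact 3) * s ^ 3"]
      by (simp only: abs_mult power_abs)
    moreover have "(\<Sum>m<3. (diff m 0 / fact m) * s ^ m) = 1 + p * s + p * (p - 1) / 2 * s\<^sup>2"
      by (simp add: diff_def eval_nat_numeral)
    ultimately show ?thesis by (simp only: eq)
  qed simp
  then show ?thesis using \<open>0 \<le> K\<close> by blast
qed

text \<open>
  For \<open>\<bar>c\<bar> \<le> 1\<close> the left-hand side is \<open>\<bar>u + x\<bar> powr r\<close> for a unit complex number \<open>u\<close> with real part \<open>c\<close>;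
  it is expanded to second order in \<open>x\<close>. The remainder has to be valid for all real \<open>x\<close>, because \<open>x\<close> will
  be Gaussian: for small \<open>x\<close> it comes from Taylor's formula, and for \<open>\<bar>x\<bar> > 1/4\<close> every term is dominated by
  \<open>\<bar>x\<bar> ^ 3 * (1 + \<bar>x\<bar>) ^ m\<close> as soon as \<open>m \<ge> r\<close>.
\<close>

lemma powr_shifted_norm_le:
  fixes r :: real
  assumes "0 < r"
  shows "\<exists>C\<ge>0. \<exists>m. \<forall>c x. \<bar>c\<bar> \<le> 1 \<longrightarrow> (1 + 2 * x * c + x\<^sup>2) powr (r / 2)
    \<le> 1 + r * c * x + (r / 2 + r * (r - 2) / 2 * c\<^sup>2) * x\<^sup>2 + C * (\<bar>x\<bar> ^ 3 * (1 + \<bar>x\<bar>) ^ m)"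
proof -
  obtain K where K: "0 \<le> K" "\<And>s. \<bar>s\<bar> \<le> 9/16 \<Longrightarrow>
      (1 + s) powr (r/2) \<le> 1 + r/2 * s + r/2 * (r/2 - 1) / 2 * s\<^sup>2 + K * \<bar>s\<bar> ^ 3"
    using powr_one_plus_taylor_le[of "r/2"] by blast
  define Q where "Q = r / 2 + \<bar>r * (r - 2)\<bar>"
  define C where "C = 27 * K + Q + 64 + 16 * r + 4 * Q"
  define m where "m = nat \<lceil>r\<rceil>"
  have "0 \<le> Q" using assms by (simp add: Q_def)
  have rm: "r \<le> real m" unfolding m_def by linarith
  have "(1 + 2 * x * c + x\<^sup>2) powr (r / 2)
    \<le> 1 + r * c * x + (r / 2 + r * (r - 2) / 2 * c\<^sup>2) * x\<^sup>2 + C * (\<bar>x\<bar> ^ 3 * (1 + \<bar>x\<bar>) ^ m)"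
    if c: "\<bar>c\<bar> \<le> 1" for c x
  proof -
    have c2: "c\<^sup>2 \<le> 1" using c by (simp add: abs_square_le_1)
    have one: "1 \<le> (1 + \<bar>x\<bar>) ^ m" by (intro one_le_power) simp
    have xc: "\<bar>x * c\<bar> \<le> \<bar>x\<bar>" using mult_left_mono[OF c, of "\<bar>x\<bar>"] by (simp add: abs_mult)
    show ?thesis
    proof (cases "\<bar>x\<bar> \<le> 1/4")
      case True
      define s where "s = 2 * x * c + x\<^sup>2"
      have x2: "x\<^sup>2 \<le> \<bar>x\<bar> / 4"
        using mult_left_mono[OF True, of "\<bar>x\<bar>"] by (simp add: power2_eq_square abs_mult_self_eq flip: abs_mult)
      have s_le: "\<bar>s\<bar> \<le> 9/4 * \<bar>x\<bar>"
        unfolding s_def using xc x2 abs_triangle_ineq[of "2 * x * c" "x\<^sup>2"]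
        by (simp add: abs_mult)
      have s3: "\<bar>s\<bar> ^ 3 \<le> 27 * \<bar>x\<bar> ^ 3"
      proof -
        have "\<bar>s\<bar> ^ 3 \<le> (3 * \<bar>x\<bar>) ^ 3" using s_le by (intro power_mono) auto
        then show ?thesis by (simp add: power_mult_distrib)
      qed
      have x3: "x ^ 4 \<le> \<bar>x\<bar> ^ 3"
      proof -
        have "x ^ 4 = \<bar>x\<bar> ^ 4" by simp
        also have "\<dots> \<le> \<bar>x\<bar> ^ 3" by (rule power_decreasing) (use True in auto)
        finally show ?thesis .
      qed
      have "(1 + s) powr (r/2) \<le> 1 + r/2 * s + r/2 * (r/2 - 1) / 2 * s\<^sup>2 + K * \<bar>s\<bar> ^ 3"
        by (rule K(2)) (use s_le True in linarith)
      also have "K * \<bar>s\<bar> ^ 3 \<le> K * (27 * \<bar>x\<bar> ^ 3)" by (intro mult_left_mono s3 K)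
      also have "1 + r/2 * s + r/2 * (r/2 - 1) / 2 * s\<^sup>2
          = 1 + r * c * x + (r / 2 + r * (r - 2) / 2 * c\<^sup>2) * x\<^sup>2
            + r * (r - 2) / 8 * (4 * c * x ^ 3 + x ^ 4)"
        by (simp add: s_def power2_eq_square power3_eq_cube power4_eq_xxxx field_simps)
      also have "r * (r - 2) / 8 * (4 * c * x ^ 3 + x ^ 4) \<le> Q * \<bar>x\<bar> ^ 3"
      proof -
        have "\<bar>4 * c * x ^ 3 + x ^ 4\<bar> \<le> 4 * (\<bar>c\<bar> * \<bar>x\<bar> ^ 3) + x ^ 4"
          by (rule order_trans[OF abs_triangle_ineq]) (simp add: abs_mult power_abs)
        also have "\<dots> \<le> 4 * (1 * \<bar>x\<bar> ^ 3) + \<bar>x\<bar> ^ 3"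
          using c x3 by (intro add_mono mult_left_mono mult_right_mono) auto
        finally have "\<bar>4 * c * x ^ 3 + x ^ 4\<bar> \<le> 8 * \<bar>x\<bar> ^ 3"
          using zero_le_power[of "\<bar>x\<bar>" 3] by linarith
        then have "\<bar>r * (r - 2) / 8\<bar> * \<bar>4 * c * x ^ 3 + x ^ 4\<bar> \<le> \<bar>r * (r - 2) / 8\<bar> * (8 * \<bar>x\<bar> ^ 3)"
          by (intro mult_left_mono) auto
        also have "\<dots> = \<bar>r * (r - 2)\<bar> * \<bar>x\<bar> ^ 3" by simp
        also have "\<dots> \<le> Q * \<bar>x\<bar> ^ 3" using assms by (intro mult_right_mono) (auto simp: Q_def)
        finally show ?thesis by (simp only: abs_mult[symmetric] abs_le_iff)
      qed
      finally have "(1 + s) powr (r/2) \<le> 1 + r * c * x + (r / 2 + r * (r - 2) / 2 * c\<^sup>2) * x\<^sup>2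
            + Q * \<bar>x\<bar> ^ 3 + K * (27 * \<bar>x\<bar> ^ 3)" by linarith
      also have "\<dots> = 1 + r * c * x + (r / 2 + r * (r - 2) / 2 * c\<^sup>2) * x\<^sup>2 + (27 * K + Q) * (\<bar>x\<bar> ^ 3 * 1)"
        by (simp add: algebra_simps)
      also have "(27 * K + Q) * (\<bar>x\<bar> ^ 3 * 1) \<le> C * (\<bar>x\<bar> ^ 3 * (1 + \<bar>x\<bar>) ^ m)"
        using one K(1) \<open>0 \<le> Q\<close> assms by (intro mult_mono) (auto simp: C_def)
      finally show ?thesis by (simp add: s_def add.assoc)
    next
      case False
      define X where "X = \<bar>x\<bar> ^ 3 * (1 + \<bar>x\<bar>) ^ m"
      have x3: "1 \<le> 64 * \<bar>x\<bar> ^ 3"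
      proof -
        have "(1/4) ^ 3 \<le> \<bar>x\<bar> ^ 3" using False by (intro power_mono) auto
        then show ?thesis by (simp add: power3_eq_cube)
      qed
      have x1: "\<bar>x\<bar> \<le> 16 * \<bar>x\<bar> ^ 3" "x\<^sup>2 \<le> 4 * \<bar>x\<bar> ^ 3"
      proof -
        have "(1/4) ^ 2 \<le> \<bar>x\<bar> ^ 2" using False by (intro power_mono) auto
        then have "1 \<le> 16 * \<bar>x\<bar>\<^sup>2" by (simp add: power2_eq_square)
        from mult_left_mono[OF this, of "\<bar>x\<bar>"] show "\<bar>x\<bar> \<le> 16 * \<bar>x\<bar> ^ 3"
          by (simp add: power2_eq_square power3_eq_cube mult_ac)
        have "\<bar>x\<bar>\<^sup>2 * 1 \<le> \<bar>x\<bar>\<^sup>2 * (4 * \<bar>x\<bar>)" using False by (intro mult_left_mono) auto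
        then show "x\<^sup>2 \<le> 4 * \<bar>x\<bar> ^ 3"
          by (simp add: power2_eq_square power3_eq_cube mult_ac)
      qed
      have X: "\<bar>x\<bar> ^ 3 \<le> X" unfolding X_def using mult_left_mono[OF one, of "\<bar>x\<bar> ^ 3"] by simp
      have "0 \<le> 1 + 2 * x * c + x\<^sup>2"
      proof -
        have "0 \<le> (x + c)\<^sup>2" by simp
        then show ?thesis using c2 by (simp add: power2_eq_square algebra_simps)
      qed
      moreover have "1 + 2 * x * c + x\<^sup>2 \<le> (1 + \<bar>x\<bar>)\<^sup>2"
        using xc by (simp add: power2_eq_square algebra_simps abs_le_iff)
      ultimately have "(1 + 2 * x * c + x\<^sup>2) powr (r / 2) \<le> ((1 + \<bar>x\<bar>)\<^sup>2) powr (r / 2)"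
        using assms by (intro powr_mono2) auto
      also have "\<dots> = (1 + \<bar>x\<bar>) powr r"
        by (simp add: powr_powr flip: powr_numeral)
      also have "\<dots> \<le> (1 + \<bar>x\<bar>) powr real m"
        using rm by (intro powr_mono) auto
      also have "\<dots> = 1 * (1 + \<bar>x\<bar>) ^ m"
        by (simp add: powr_realpow add_pos_nonneg)
      also have "\<dots> \<le> (64 * \<bar>x\<bar> ^ 3) * (1 + \<bar>x\<bar>) ^ m"
        using x3 by (intro mult_right_mono) auto
      also have "\<dots> = 64 * X" by (simp add: X_def)
      finally have main: "(1 + 2 * x * c + x\<^sup>2) powr (r / 2) \<le> 64 * X" .
      have "\<bar>r * c * x\<bar> \<le> r * \<bar>x\<bar>"
        using xc assms by (simp add: abs_mult mult_ac)
      also have "\<dots> \<le> r * (16 * X)" using x1(1) X assms by (intro mult_left_mono) auto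
      finally have lin: "- (16 * r * X) \<le> r * c * x" by (simp add: abs_le_iff mult_ac)
      have "\<bar>(r / 2 + r * (r - 2) / 2 * c\<^sup>2) * x\<^sup>2\<bar> \<le> Q * (4 * X)"
        unfolding abs_mult
      proof (intro mult_mono)
        have "\<bar>r * (r - 2) / 2 * c\<^sup>2\<bar> \<le> \<bar>r * (r - 2) / 2\<bar> * 1"
          unfolding abs_mult using c2 by (intro mult_left_mono) auto
        then show "\<bar>r / 2 + r * (r - 2) / 2 * c\<^sup>2\<bar> \<le> Q"
          unfolding Q_def using assms by (simp add: abs_le_iff)
        show "\<bar>x\<^sup>2\<bar> \<le> 4 * X" using x1(2) X by simp
      qed (use \<open>0 \<le> Q\<close> in auto)
      then have quad: "- (4 * Q * X) \<le> (r / 2 + r * (r - 2) / 2 * c\<^sup>2) * x\<^sup>2"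
        by (simp add: abs_le_iff mult_ac)
      have "0 \<le> (27 * K + Q) * X"
        using K(1) \<open>0 \<le> Q\<close> by (simp add: X_def)
      then have "64 * X \<le> C * X - 16 * r * X - 4 * Q * X"
        by (simp add: C_def algebra_simps)
      then show ?thesis
        using main lin quad unfolding X_def[symmetric] by linarith
    qed
  qed
  moreover have "0 \<le> C" using K(1) \<open>0 \<le> Q\<close> assms by (simp add: C_def)
  ultimately show ?thesis by blast
qed

lemma nn_integral_centered_normal:
  assumes "0 < \<sigma>" and [measurable]: "f \<in> borel_measurable borel"
  shows "(\<integral>\<^sup>+x. f x \<partial>density lborel (normal_density 0 \<sigma>))
    = (\<integral>\<^sup>+x. ennreal (std_normal_density x) * f (\<sigma> * x) \<partial>lborel)"
proof -
  have "(\<integral>\<^sup>+x. f x \<partial>density lborel (normal_density 0 \<sigma>))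
      = (\<integral>\<^sup>+x. ennreal (normal_density 0 \<sigma> x) * f x \<partial>lborel)"
    by (simp add: nn_integral_density)
  also have "\<dots> = ennreal \<bar>\<sigma>\<bar> * (\<integral>\<^sup>+x. ennreal (normal_density 0 \<sigma> (0 + \<sigma> * x)) * f (0 + \<sigma> * x) \<partial>lborel)"
    using assms by (intro nn_integral_real_affine) auto
  also have "\<dots> = (\<integral>\<^sup>+x. ennreal \<sigma> * (ennreal (normal_density 0 \<sigma> (\<sigma> * x)) * f (\<sigma> * x)) \<partial>lborel)"
    using assms by (simp add: nn_integral_cmult)
  also have "\<dots> = (\<integral>\<^sup>+x. ennreal (std_normal_density x) * f (\<sigma> * x) \<partial>lborel)"
  proof (intro nn_integral_cong)
    fix x
    have "\<sigma> * normal_density 0 \<sigma> (\<sigma> * x) = std_normal_density x"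
      using assms by (simp add: normal_density_def real_sqrt_mult power_mult_distrib)
    then show "ennreal \<sigma> * (ennreal (normal_density 0 \<sigma> (\<sigma> * x)) * f (\<sigma> * x))
        = ennreal (std_normal_density x) * f (\<sigma> * x)"
      using assms by (simp add: mult.assoc[symmetric] ennreal_mult[symmetric])
  qed
  finally show ?thesis .
qed

text \<open>
  The linear term of the expansion has mean zero and the quadratic one contributes the variance.
\<close>

lemma nn_integral_normal_shifted_norm_le:
  fixes r :: real
  assumes "0 < r"
  shows "\<exists>C\<ge>0. \<forall>c \<sigma>. \<bar>c\<bar> \<le> 1 \<longrightarrow> 0 < \<sigma> \<longrightarrow> \<sigma> \<le> 1 \<longrightarrow>
    (\<integral>\<^sup>+x. ennreal ((1 + 2 * x * c + x\<^sup>2) powr (r / 2)) \<partial>density lborel (normal_density 0 \<sigma>))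
      \<le> ennreal (1 + (r / 2 + r * (r - 2) / 2 * c\<^sup>2) * \<sigma>\<^sup>2 + C * \<sigma> ^ 3)"
proof -
  obtain C m where C: "0 \<le> C" "\<And>c x. \<bar>c\<bar> \<le> 1 \<Longrightarrow> (1 + 2 * x * c + x\<^sup>2) powr (r / 2)
    \<le> 1 + r * c * x + (r / 2 + r * (r - 2) / 2 * c\<^sup>2) * x\<^sup>2 + C * (\<bar>x\<bar> ^ 3 * (1 + \<bar>x\<bar>) ^ m)"
    using powr_shifted_norm_le[OF assms] by metis
  define E where "E = (\<integral>x. std_normal_density x * \<bar>x\<bar> ^ 3 \<partial>lborel) + (\<integral>x. std_normal_density x * \<bar>x\<bar> ^ (3 + m) \<partial>lborel)"
  have "0 \<le> E"
    unfolding E_def by (intro add_nonneg_nonneg integral_nonneg_AE) auto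
  define C' where "C' = C * 2 ^ m * E"
  have "(\<integral>\<^sup>+x. ennreal ((1 + 2 * x * c + x\<^sup>2) powr (r / 2)) \<partial>density lborel (normal_density 0 \<sigma>))
      \<le> ennreal (1 + (r / 2 + r * (r - 2) / 2 * c\<^sup>2) * \<sigma>\<^sup>2 + C' * \<sigma> ^ 3)"
    if c: "\<bar>c\<bar> \<le> 1" and \<sigma>: "0 < \<sigma>" "\<sigma> \<le> 1" for c \<sigma>
  proof -
    define b where "b = r / 2 + r * (r - 2) / 2 * c\<^sup>2"
    define G where "G x = std_normal_density x + r * c * \<sigma> * (std_normal_density x * x)
      + b * \<sigma>\<^sup>2 * (std_normal_density x * x\<^sup>2)
      + C * \<sigma> ^ 3 * 2 ^ m * (std_normal_density x * \<bar>x\<bar> ^ 3 + std_normal_density x * \<bar>x\<bar> ^ (3 + m))" for x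
    have le: "std_normal_density x * ((1 + 2 * (\<sigma> * x) * c + (\<sigma> * x)\<^sup>2) powr (r / 2)) \<le> G x" for x
    proof -
      have "\<bar>\<sigma> * x\<bar> ^ 3 * (1 + \<bar>\<sigma> * x\<bar>) ^ m \<le> (\<sigma> ^ 3 * \<bar>x\<bar> ^ 3) * (2 ^ m * (1 + \<bar>x\<bar> ^ m))"
      proof (intro mult_mono)
        have "(1 + \<bar>\<sigma> * x\<bar>) ^ m \<le> (1 + \<bar>x\<bar>) ^ m"
          using \<sigma> by (intro power_mono) (auto simp: abs_mult mult_left_le_one_le)
        also have "\<dots> \<le> (2 * max 1 \<bar>x\<bar>) ^ m" by (intro power_mono) auto
        also have "\<dots> \<le> 2 ^ m * (1 + \<bar>x\<bar> ^ m)"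
          by (auto simp: power_mult_distrib max_def)
        finally show "(1 + \<bar>\<sigma> * x\<bar>) ^ m \<le> 2 ^ m * (1 + \<bar>x\<bar> ^ m)" .
      qed (use \<sigma> in \<open>auto simp: abs_mult power_mult_distrib\<close>)
      then have "C * (\<bar>\<sigma> * x\<bar> ^ 3 * (1 + \<bar>\<sigma> * x\<bar>) ^ m) \<le> C * ((\<sigma> ^ 3 * \<bar>x\<bar> ^ 3) * (2 ^ m * (1 + \<bar>x\<bar> ^ m)))"
        using C(1) by (rule mult_left_mono)
      with C(2)[OF c, of "\<sigma> * x"]
      have "(1 + 2 * (\<sigma> * x) * c + (\<sigma> * x)\<^sup>2) powr (r / 2)
        \<le> 1 + r * c * (\<sigma> * x) + b * (\<sigma> * x)\<^sup>2 + C * ((\<sigma> ^ 3 * \<bar>x\<bar> ^ 3) * (2 ^ m * (1 + \<bar>x\<bar> ^ m)))"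
        unfolding b_def by linarith
      from mult_left_mono[OF this, of "std_normal_density x"] show ?thesis
        by (simp add: G_def algebra_simps power_mult_distrib power_add)
    qed
    have m1: "has_bochner_integral lborel (\<lambda>x. std_normal_density x * x) 0"
      using std_normal_moment_odd[of 0] by simp
    have m2: "has_bochner_integral lborel (\<lambda>x. std_normal_density x * x\<^sup>2) 1"
      using std_normal_moment_even[of 1] by simp
    have m0: "has_bochner_integral lborel std_normal_density 1"
      using std_normal_moment_even[of 0] by simp
    have m3: "has_bochner_integral lborel (\<lambda>x. std_normal_density x * \<bar>x\<bar> ^ 3 + std_normal_density x * \<bar>x\<bar> ^ (3 + m)) E"
      unfolding E_def by (intro has_bochner_integral_add has_bochner_integral_integrable integrable_std_normal_moment_abs)
    have G: "has_bochner_integral lborel G (1 + r * c * \<sigma> * 0 + b * \<sigma>\<^sup>2 * 1 + C * \<sigma> ^ 3 * 2 ^ m * E)"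
      unfolding G_def
      by (intro has_bochner_integral_add has_bochner_integral_mult_right m0 m1 m2 m3)
    have G0: "0 \<le> G x" for x
      by (rule order_trans[OF _ le]) auto
    have "(\<integral>\<^sup>+x. ennreal ((1 + 2 * x * c + x\<^sup>2) powr (r / 2)) \<partial>density lborel (normal_density 0 \<sigma>))
        = (\<integral>\<^sup>+x. ennreal (std_normal_density x) * ennreal ((1 + 2 * (\<sigma> * x) * c + (\<sigma> * x)\<^sup>2) powr (r / 2)) \<partial>lborel)"
      using \<sigma>(1) by (intro nn_integral_centered_normal) measurable
    also have "\<dots> \<le> (\<integral>\<^sup>+x. ennreal (G x) \<partial>lborel)"
      using le by (intro nn_integral_mono) (simp add: ennreal_mult[symmetric] ennreal_leI)
    also have "\<dots> = ennreal (1 + r * c * \<sigma> * 0 + b * \<sigma>\<^sup>2 * 1 + C * \<sigma> ^ 3 * 2 ^ m * E)"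
      using G G0 by (subst nn_integral_eq_integral) (auto simp: has_bochner_integral_iff)
    also have "\<dots> = ennreal (1 + b * \<sigma>\<^sup>2 + C' * \<sigma> ^ 3)"
      by (simp add: C'_def mult_ac)
    finally show ?thesis by (simp add: b_def)
  qed
  moreover have "0 \<le> C'" using C(1) \<open>0 \<le> E\<close> by (simp add: C'_def)
  ultimately show ?thesis by blast
qed

section \<open>One step of the scheme in expectation\<close>

text \<open>
  With \<open>d\<close> the spatial derivative of the reverse flow and \<open>c = X + \<i> Y\<close> its centred position, this is
  \<open>\<bar>d\<bar> powr \<mu> * Y powr \<zeta> * (sin (arg c)) powr (- r)\<close>. For reverse SLE and suitable exponents
  it is the local martingale of Rohde and Schramm.
\<close>

definition rev_loewner_functional :: "real \<Rightarrow> real \<Rightarrow> real \<Rightarrow> complex \<Rightarrow> complex \<Rightarrow> real" where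
  "rev_loewner_functional \<mu> \<zeta> r d c = cmod d powr \<mu> * Im c powr (\<zeta> - r) * cmod c powr r"

lemma borel_measurable_rev_loewner_functional[measurable]:
  assumes [measurable]: "f \<in> borel_measurable M" "g \<in> borel_measurable M"
  shows "(\<lambda>x. rev_loewner_functional \<mu> \<zeta> r (f x) (g x)) \<in> borel_measurable M"
  unfolding rev_loewner_functional_def by measurable

text \<open>
  The factor of \<open>\<sigma>\<^sup>2 / 2\<close> is the second derivative of \<open>\<bar>w + x\<bar> powr r\<close> at \<open>x = 0\<close>, divided by
  \<open>\<bar>w\<bar> powr r\<close>: the contribution of the heat flow in the real direction. It is expressed by \<open>1 / \<bar>w\<bar>\<^sup>2\<close> and \<open>Re (1 / w\<^sup>2)\<close>
  because the same two quantities describe the drift.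
\<close>

lemma nn_integral_gaussian_shift_norm_powr_le:
  fixes r :: real
  assumes "0 < r"
  shows "\<exists>C\<ge>0. \<forall>w \<sigma>. 0 < \<sigma> \<longrightarrow> \<sigma> \<le> cmod w \<longrightarrow>
    (\<integral>\<^sup>+x. ennreal (cmod (w + of_real (\<sigma> * x)) powr r) \<partial>density lborel std_normal_density)
      \<le> ennreal (cmod w powr r * exp (\<sigma>\<^sup>2 / 2 * (r\<^sup>2 / 2 / (cmod w)\<^sup>2 + r * (r - 2) / 2 * Re (1 / w\<^sup>2))
          + C * (\<sigma> / cmod w) ^ 3))"
proof -
  obtain C where C: "0 \<le> C" "\<And>c \<sigma>. \<bar>c\<bar> \<le> 1 \<Longrightarrow> 0 < \<sigma> \<Longrightarrow> \<sigma> \<le> 1 \<Longrightarrow>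
    (\<integral>\<^sup>+x. ennreal ((1 + 2 * x * c + x\<^sup>2) powr (r / 2)) \<partial>density lborel (normal_density 0 \<sigma>))
      \<le> ennreal (1 + (r / 2 + r * (r - 2) / 2 * c\<^sup>2) * \<sigma>\<^sup>2 + C * \<sigma> ^ 3)"
    using nn_integral_normal_shifted_norm_le[OF assms] by blast
  have "(\<integral>\<^sup>+x. ennreal (cmod (w + of_real (\<sigma> * x)) powr r) \<partial>density lborel std_normal_density)
      \<le> ennreal (cmod w powr r * exp (\<sigma>\<^sup>2 / 2 * (r\<^sup>2 / 2 / (cmod w)\<^sup>2 + r * (r - 2) / 2 * Re (1 / w\<^sup>2))
          + C * (\<sigma> / cmod w) ^ 3))"
    if \<sigma>: "0 < \<sigma>" "\<sigma> \<le> cmod w" for w \<sigma>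
  proof -
    define c where "c = Re w / cmod w"
    define s where "s = \<sigma> / cmod w"
    have w: "0 < cmod w" using \<sigma> by linarith
    have s: "0 < s" "s \<le> 1" using \<sigma> w by (auto simp: s_def)
    have c: "\<bar>c\<bar> \<le> 1" using w abs_Re_le_cmod[of w] by (simp add: c_def)
    have norm_eq: "cmod (w + of_real (\<sigma> * x)) powr r
        = cmod w powr r * (1 + 2 * (s * x) * c + (s * x)\<^sup>2) powr (r / 2)" for x
    proof -
      have "(cmod (w + of_real (\<sigma> * x)))\<^sup>2 = (cmod w)\<^sup>2 + 2 * (\<sigma> * x) * Re w + (\<sigma> * x)\<^sup>2"
        unfolding cmod_power2 by (simp add: power2_eq_square algebra_simps)
      also have "\<dots> = (cmod w)\<^sup>2 * (1 + 2 * (s * x) * c + (s * x)\<^sup>2)"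
        using w by (simp add: s_def c_def power2_eq_square field_simps)
      finally have eq: "(cmod (w + of_real (\<sigma> * x)))\<^sup>2 = (cmod w)\<^sup>2 * (1 + 2 * (s * x) * c + (s * x)\<^sup>2)" .
      have sq: "a powr r = (a\<^sup>2) powr (r / 2)" if "0 \<le> a" for a :: real
        using that by (cases "a = 0") (simp_all add: powr_powr flip: powr_numeral)
      have "cmod (w + of_real (\<sigma> * x)) powr r = ((cmod w)\<^sup>2 * (1 + 2 * (s * x) * c + (s * x)\<^sup>2)) powr (r / 2)"
        by (simp only: sq[OF norm_ge_zero] eq)
      also have "\<dots> = cmod w powr r * (1 + 2 * (s * x) * c + (s * x)\<^sup>2) powr (r / 2)"
        by (subst powr_mult) (auto simp: sq[of "cmod w"])
      finally show ?thesis .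
    qed
    have "(\<integral>\<^sup>+x. ennreal (cmod (w + of_real (\<sigma> * x)) powr r) \<partial>density lborel std_normal_density)
        = (\<integral>\<^sup>+x. ennreal (cmod w powr r) * (ennreal (std_normal_density x) *
            ennreal ((1 + 2 * (s * x) * c + (s * x)\<^sup>2) powr (r / 2))) \<partial>lborel)"
      unfolding norm_eq by (subst nn_integral_density)
        (auto intro!: nn_integral_cong simp: ennreal_mult mult_ac)
    also have "\<dots> = ennreal (cmod w powr r) *
        (\<integral>\<^sup>+x. ennreal (std_normal_density x) * ennreal ((1 + 2 * (s * x) * c + (s * x)\<^sup>2) powr (r / 2)) \<partial>lborel)"
      by (rule nn_integral_cmult) measurable
    also have "(\<integral>\<^sup>+x. ennreal (std_normal_density x) * ennreal ((1 + 2 * (s * x) * c + (s * x)\<^sup>2) powr (r / 2)) \<partial>lborel)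
        = (\<integral>\<^sup>+x. ennreal ((1 + 2 * x * c + x\<^sup>2) powr (r / 2)) \<partial>density lborel (normal_density 0 s))"
      using s(1) by (intro nn_integral_centered_normal[symmetric]) measurable
    also have "\<dots> \<le> ennreal (1 + (r / 2 + r * (r - 2) / 2 * c\<^sup>2) * s\<^sup>2 + C * s ^ 3)"
      by (rule C(2)[OF c s])
    also have "\<dots> \<le> ennreal (exp ((r / 2 + r * (r - 2) / 2 * c\<^sup>2) * s\<^sup>2 + C * s ^ 3))"
      using exp_ge_add_one_self[of "(r / 2 + r * (r - 2) / 2 * c\<^sup>2) * s\<^sup>2 + C * s ^ 3"]
      by (intro ennreal_leI) (simp add: add.assoc)
    also have "(r / 2 + r * (r - 2) / 2 * c\<^sup>2) * s\<^sup>2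
        = \<sigma>\<^sup>2 / 2 * (r\<^sup>2 / 2 / (cmod w)\<^sup>2 + r * (r - 2) / 2 * Re (1 / w\<^sup>2))"
    proof -
      have "Re (1 / w\<^sup>2) = ((Re w)\<^sup>2 - (Im w)\<^sup>2) / ((cmod w)\<^sup>2)\<^sup>2"
        unfolding cmod_power2 by (simp add: Re_divide power2_eq_square algebra_simps)
      also have "(Im w)\<^sup>2 = (cmod w)\<^sup>2 - (Re w)\<^sup>2" by (simp add: cmod_power2)
      finally have Re_eq: "Re (1 / w\<^sup>2) = (2 * c\<^sup>2 - 1) / (cmod w)\<^sup>2"
        using w by (simp add: c_def power2_eq_square field_simps)
      show ?thesis
        unfolding Re_eq s_def using w by (simp add: power_divide) (simp add: power2_eq_square field_simps)
    qed
    finally show ?thesis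
      by (simp add: ennreal_mult[symmetric] mult_left_mono s_def)
  qed
  then show ?thesis using C(1) by blast
qed

lemma ln_norm_one_plus_le:
  fixes \<tau> :: complex
  assumes "1 + \<tau> \<noteq> 0"
  shows "ln (cmod (1 + \<tau>)) \<le> Re \<tau> + (cmod \<tau>)\<^sup>2 / 2"
proof -
  have "2 * ln (cmod (1 + \<tau>)) = ln ((cmod (1 + \<tau>))\<^sup>2)"
    using assms by (simp add: ln_realpow)
  also have "\<dots> \<le> (cmod (1 + \<tau>))\<^sup>2 - 1"
    using assms by (intro ln_le_minus_one) auto
  also have "\<dots> = 2 * Re \<tau> + (cmod \<tau>)\<^sup>2"
    unfolding cmod_power2 by (simp add: power2_eq_square algebra_simps)
  finally show ?thesis by simp
qed

text \<open>
  With \<open>\<tau> = h / z\<^sup>2\<close> an Euler step multiplies \<open>d\<close>, \<open>Im z\<close> and \<open>z\<close> by \<open>1 + 2 \<tau>\<close>, \<open>1 + 2 \<bar>\<tau>\<bar>\<close> and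
  \<open>1 - 2 \<tau>\<close>. The logarithm of the functional therefore changes by an explicit amount, which is linear
  in \<open>Re \<tau>\<close> and \<open>\<bar>\<tau>\<bar>\<close> up to an error of order \<open>\<bar>\<tau>\<bar>\<^sup>2\<close>.
\<close>

lemma euler_step_functional_le:
  fixes \<mu> \<zeta> r h :: real and z :: complex
  assumes "0 \<le> \<mu>" "0 \<le> r" and y: "0 < y" "y \<le> Im z" and h: "0 < h" "h \<le> y\<^sup>2 / 4"
  shows "rev_loewner_functional \<mu> \<zeta> r (d * (1 + of_real (2 * h) / z\<^sup>2)) (z - of_real (2 * h) / z)
    \<le> rev_loewner_functional \<mu> \<zeta> r d z *
      exp (h * (2 * (\<mu> - r) * Re (1 / z\<^sup>2) + 2 * (\<zeta> - r) / (cmod z)\<^sup>2)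
         + (2 * \<mu> + 2 * r + 4 * \<bar>\<zeta> - r\<bar>) * (h / y\<^sup>2)\<^sup>2)"
proof -
  define \<tau> where "\<tau> = of_real h / z\<^sup>2"
  define a where "a = cmod \<tau>"
  have yz: "y \<le> cmod z" using y abs_Im_le_cmod[of z] by linarith
  then have z: "z \<noteq> 0" "0 < cmod z" using y by auto
  have a_eq: "a = h / (cmod z)\<^sup>2" using h by (simp add: a_def \<tau>_def norm_divide norm_power)
  have a_le: "a \<le> h / y\<^sup>2"
    unfolding a_eq using h y yz by (intro divide_left_mono power_mono mult_pos_pos) auto
  also have "h / y\<^sup>2 \<le> 1 / 4" using h y by (simp add: divide_le_eq)
  finally have a_4: "a \<le> 1 / 4" .
  have a0: "0 \<le> a" by (simp add: a_def)
  have ne: "1 + 2 * \<tau> \<noteq> 0" "1 + - (2 * \<tau>) \<noteq> 0"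
  proof -
    have small: "cmod (2 * \<tau>) < 1" using a_4 by (simp add: a_def norm_mult)
    show "1 + 2 * \<tau> \<noteq> 0"
    proof
      assume "1 + 2 * \<tau> = 0"
      then have "2 * \<tau> = -1" by (simp add: add_eq_0_iff)
      then show False using small by simp
    qed
    show "1 + - (2 * \<tau>) \<noteq> 0"
    proof
      assume "1 + - (2 * \<tau>) = 0"
      then have "2 * \<tau> = 1" by simp
      then show False using small by simp
    qed
  qed
  have l1: "cmod (1 + 2 * \<tau>) \<le> exp (2 * Re \<tau> + 2 * a\<^sup>2)"
  proof -
    have "exp (ln (cmod (1 + 2 * \<tau>))) \<le> exp (2 * Re \<tau> + 2 * a\<^sup>2)"
      using ln_norm_one_plus_le[OF ne(1)]
      by (intro exp_le_cancel_iff[THEN iffD2]) (simp add: norm_mult power_mult_distrib a_def)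
    moreover have "0 < cmod (1 + 2 * \<tau>)" by (rule zero_less_norm_iff[THEN iffD2, OF ne(1)])
    ultimately show ?thesis by (simp only: exp_ln)
  qed
  have l2: "cmod (1 + - (2 * \<tau>)) \<le> exp (- 2 * Re \<tau> + 2 * a\<^sup>2)"
  proof -
    have "exp (ln (cmod (1 + - (2 * \<tau>)))) \<le> exp (- 2 * Re \<tau> + 2 * a\<^sup>2)"
      using ln_norm_one_plus_le[OF ne(2)]
      by (intro exp_le_cancel_iff[THEN iffD2]) (simp add: norm_mult power_mult_distrib a_def)
    moreover have "0 < cmod (1 + - (2 * \<tau>))" by (rule zero_less_norm_iff[THEN iffD2, OF ne(2)])
    ultimately show ?thesis by (simp only: exp_ln)
  qed
  have l3: "(1 + 2 * a) powr (\<zeta> - r) \<le> exp (2 * (\<zeta> - r) * a + 4 * \<bar>\<zeta> - r\<bar> * a\<^sup>2)"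
  proof -
    have "2 * a - (2 * a)\<^sup>2 \<le> ln (1 + 2 * a)"
      using a0 a_4 by (intro ln_one_plus_pos_lower_bound) auto
    moreover have "ln (1 + 2 * a) \<le> 2 * a" using a0 by (intro ln_add_one_self_le_self) auto
    ultimately have "\<bar>ln (1 + 2 * a) - 2 * a\<bar> \<le> 4 * a\<^sup>2"
      by (simp add: abs_le_iff power_mult_distrib)
    then have "\<bar>\<zeta> - r\<bar> * \<bar>ln (1 + 2 * a) - 2 * a\<bar> \<le> \<bar>\<zeta> - r\<bar> * (4 * a\<^sup>2)"
      by (intro mult_left_mono) auto
    then have "(\<zeta> - r) * (ln (1 + 2 * a) - 2 * a) \<le> \<bar>\<zeta> - r\<bar> * (4 * a\<^sup>2)"
      unfolding abs_mult[symmetric] by (rule abs_le_D1)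
    then show ?thesis
      using a0 by (simp add: powr_def algebra_simps)
  qed
  have "1 + of_real (2 * h) / z\<^sup>2 = 1 + 2 * \<tau>" by (simp add: \<tau>_def)
  moreover have "Im (z - of_real (2 * h) / z) = Im z * (1 + 2 * a)"
    by (simp add: Im_divide a_eq cmod_power2 algebra_simps)
  moreover have "z - of_real (2 * h) / z = z * (1 + - (2 * \<tau>))"
    using z by (simp add: \<tau>_def power2_eq_square field_simps)
  ultimately have "rev_loewner_functional \<mu> \<zeta> r (d * (1 + of_real (2 * h) / z\<^sup>2)) (z - of_real (2 * h) / z)
      = rev_loewner_functional \<mu> \<zeta> r d z *
        (cmod (1 + 2 * \<tau>) powr \<mu> * (1 + 2 * a) powr (\<zeta> - r) * cmod (1 + - (2 * \<tau>)) powr r)"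
    using y a0 by (simp only: rev_loewner_functional_def norm_mult) (simp add: powr_mult)
  also have "\<dots> \<le> rev_loewner_functional \<mu> \<zeta> r d z *
        (exp (2 * Re \<tau> + 2 * a\<^sup>2) powr \<mu> * exp (2 * (\<zeta> - r) * a + 4 * \<bar>\<zeta> - r\<bar> * a\<^sup>2)
          * exp (- 2 * Re \<tau> + 2 * a\<^sup>2) powr r)"
    using assms(1,2) l1 l2 l3
    by (intro mult_left_mono mult_mono powr_mono2) (auto simp: rev_loewner_functional_def)
  also have "exp (2 * Re \<tau> + 2 * a\<^sup>2) powr \<mu> * exp (2 * (\<zeta> - r) * a + 4 * \<bar>\<zeta> - r\<bar> * a\<^sup>2)
          * exp (- 2 * Re \<tau> + 2 * a\<^sup>2) powr r
      = exp (2 * (\<mu> - r) * Re \<tau> + 2 * (\<zeta> - r) * a + (2 * \<mu> + 2 * r + 4 * \<bar>\<zeta> - r\<bar>) * a\<^sup>2)"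
    by (simp add: powr_def exp_add[symmetric] algebra_simps)
  also have "\<dots> \<le> exp (2 * (\<mu> - r) * Re \<tau> + 2 * (\<zeta> - r) * a
      + (2 * \<mu> + 2 * r + 4 * \<bar>\<zeta> - r\<bar>) * (h / y\<^sup>2)\<^sup>2)"
    using a_le a0 assms(1,2) by (intro exp_le_cancel_iff[THEN iffD2] add_left_mono mult_left_mono power_mono) auto
  also have "2 * (\<mu> - r) * Re \<tau> + 2 * (\<zeta> - r) * a
      = h * (2 * (\<mu> - r) * Re (1 / z\<^sup>2) + 2 * (\<zeta> - r) / (cmod z)\<^sup>2)"
  proof -
    have "\<tau> = of_real h * (1 / z\<^sup>2)" by (simp add: \<tau>_def)
    then have "Re \<tau> = h * Re (1 / z\<^sup>2)" by (simp only: Re_complex_of_real times_complex.simps Im_complex_of_real)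
    then show ?thesis by (simp add: a_eq algebra_simps diff_divide_distrib)
  qed
  finally show ?thesis
    by (auto simp: rev_loewner_functional_def mult_left_mono)
qed

lemma norm_inverse_square_diff_le:
  fixes w z :: complex
  assumes "0 < y" "y \<le> cmod w" "y \<le> cmod z"
  shows "cmod (1 / w\<^sup>2 - 1 / z\<^sup>2) \<le> 2 * cmod (w - z) / y ^ 3"
proof -
  have nz: "w \<noteq> 0" "z \<noteq> 0" using assms by auto
  have eq: "1 / w\<^sup>2 - 1 / z\<^sup>2 = (z - w) * (1 / (w * z\<^sup>2) + 1 / (w\<^sup>2 * z))"
    using nz by (simp add: power2_eq_square field_simps)
  have "cmod (1 / (w * z\<^sup>2) + 1 / (w\<^sup>2 * z)) \<le> 1 / y ^ 3 + 1 / y ^ 3"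
  proof (rule norm_triangle_mono)
    have "y ^ 3 \<le> cmod w * (cmod z)\<^sup>2"
      using assms by (auto simp: power3_eq_cube power2_eq_square mult.assoc intro!: mult_mono)
    then show "cmod (1 / (w * z\<^sup>2)) \<le> 1 / y ^ 3"
      using assms by (auto simp: norm_divide norm_mult norm_power intro!: frac_le)
    have "y ^ 3 \<le> (cmod w)\<^sup>2 * cmod z"
      using assms by (auto simp: power3_eq_cube power2_eq_square mult.assoc intro!: mult_mono)
    then show "cmod (1 / (w\<^sup>2 * z)) \<le> 1 / y ^ 3"
      using assms by (auto simp: norm_divide norm_mult norm_power intro!: frac_le)
  qed
  then have "cmod (z - w) * cmod (1 / (w * z\<^sup>2) + 1 / (w\<^sup>2 * z)) \<le> cmod (z - w) * (1 / y ^ 3 + 1 / y ^ 3)"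
    by (rule mult_left_mono) simp
  then show ?thesis
    unfolding eq norm_mult by (simp add: norm_minus_commute mult.commute)
qed

text \<open>
  The hypotheses on the exponents say that the drift of the functional, as found in
  \<open>euler_step_functional_le\<close>, is opposite to the contribution of the Gaussian increment in
  \<open>nn_integral_gaussian_shift_norm_powr_le\<close>. What survives is of order \<open>h powr (3/2)\<close>, so the
  total over \<open>t / h\<close> steps vanishes as \<open>h\<close> tends to zero. The drift is evaluated at \<open>z\<close> and the Gaussian
  term at the point \<open>w\<close> reached from it; their difference is of order \<open>h\<^sup>2\<close>.
\<close>

lemma nn_integral_rev_loewner_functional_step_le:
  fixes \<kappa> r \<mu> \<zeta> :: real
  assumes "0 < \<kappa>" "0 < r" "0 \<le> \<mu>"
    and \<zeta>: "\<kappa> * r\<^sup>2 / 4 + 2 * (\<zeta> - r) = 0"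
    and \<mu>: "\<kappa> * r * (r - 2) / 4 + 2 * (\<mu> - r) = 0"
  shows "\<exists>C. \<forall>y h z d. 0 < y \<longrightarrow> y \<le> Im z \<longrightarrow> 0 < h \<longrightarrow> h \<le> y\<^sup>2 / 4 \<longrightarrow> \<kappa> * h \<le> y\<^sup>2 \<longrightarrow>
    (\<integral>\<^sup>+x. ennreal (rev_loewner_functional \<mu> \<zeta> r (d * (1 + of_real (2 * h) / z\<^sup>2))
        (z - of_real (2 * h) / z + of_real (sqrt \<kappa> * x))) \<partial>density lborel (normal_density 0 (sqrt h)))
      \<le> ennreal (rev_loewner_functional \<mu> \<zeta> r d z * exp (C * (sqrt h / y) ^ 3))"
proof -
  obtain C1 where C1: "0 \<le> C1" "\<And>w \<sigma>. 0 < \<sigma> \<Longrightarrow> \<sigma> \<le> cmod w \<Longrightarrow>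
    (\<integral>\<^sup>+x. ennreal (cmod (w + of_real (\<sigma> * x)) powr r) \<partial>density lborel std_normal_density)
      \<le> ennreal (cmod w powr r * exp (\<sigma>\<^sup>2 / 2 * (r\<^sup>2 / 2 / (cmod w)\<^sup>2 + r * (r - 2) / 2 * Re (1 / w\<^sup>2))
          + C1 * (\<sigma> / cmod w) ^ 3))"
    using nn_integral_gaussian_shift_norm_powr_le[OF \<open>0 < r\<close>] by blast
  define C2 where "C2 = 2 * \<mu> + 2 * r + 4 * \<bar>\<zeta> - r\<bar>"
  define C3 where "C3 = \<kappa> / 2 * (r\<^sup>2 / 2 + \<bar>r * (r - 2) / 2\<bar>)"
  define C where "C = C1 * sqrt \<kappa> ^ 3 + C2 + C3 * 4"
  have C23: "0 \<le> C2" "0 \<le> C3" using assms by (auto simp: C2_def C3_def)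
  have "(\<integral>\<^sup>+x. ennreal (rev_loewner_functional \<mu> \<zeta> r (d * (1 + of_real (2 * h) / z\<^sup>2))
        (z - of_real (2 * h) / z + of_real (sqrt \<kappa> * x))) \<partial>density lborel (normal_density 0 (sqrt h)))
      \<le> ennreal (rev_loewner_functional \<mu> \<zeta> r d z * exp (C * (sqrt h / y) ^ 3))"
    if y: "0 < y" "y \<le> Im z" and h: "0 < h" "h \<le> y\<^sup>2 / 4" and \<kappa>h: "\<kappa> * h \<le> y\<^sup>2" for y h z d
  proof -
    define w where "w = z - of_real (2 * h) / z"
    define d' where "d' = d * (1 + of_real (2 * h) / z\<^sup>2)"
    define \<sigma> where "\<sigma> = sqrt (\<kappa> * h)"
    define \<rho> where "\<rho> = sqrt h / y"
    define B where "B v = \<kappa> / 2 * (r\<^sup>2 / 2 / (cmod v)\<^sup>2 + r * (r - 2) / 2 * Re (1 / v\<^sup>2))" for v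
    have \<sigma>: "0 < \<sigma>" "\<sigma> \<le> y" "\<sigma>\<^sup>2 = \<kappa> * h"
      using assms(1) h \<kappa>h y real_sqrt_le_mono[OF \<kappa>h] by (auto simp: \<sigma>_def)
    have \<rho>: "0 \<le> \<rho>" "\<rho>\<^sup>2 = h / y\<^sup>2" "\<rho> \<le> 1"
    proof -
      show "0 \<le> \<rho>" "\<rho>\<^sup>2 = h / y\<^sup>2" using h y by (auto simp: \<rho>_def power_divide)
      moreover have "h / y\<^sup>2 \<le> 1" using h y by (simp add: divide_le_eq)
      ultimately show "\<rho> \<le> 1" using power2_le_imp_le[of \<rho> 1] by simp
    qed
    have Im_w: "y \<le> Im w"
    proof -
      have "Im z * 1 \<le> Im z * (1 + 2 * h / (cmod z)\<^sup>2)" using y h by (intro mult_left_mono) auto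
      then have "y \<le> Im z * (1 + 2 * h / (cmod z)\<^sup>2)" using y by linarith
      then show ?thesis using Im_euler_step[of z h 0] by (simp only: w_def of_real_0 add_0_right)
    qed
    have yw: "y \<le> cmod w" and yz: "y \<le> cmod z"
      using Im_w y abs_Im_le_cmod[of w] abs_Im_le_cmod[of z] by linarith+
    have "(\<integral>\<^sup>+x. ennreal (rev_loewner_functional \<mu> \<zeta> r d' (w + of_real (sqrt \<kappa> * x)))
          \<partial>density lborel (normal_density 0 (sqrt h)))
        = (\<integral>\<^sup>+x. ennreal (std_normal_density x) *
            ennreal (rev_loewner_functional \<mu> \<zeta> r d' (w + of_real (sqrt \<kappa> * (sqrt h * x)))) \<partial>lborel)"
      using h by (intro nn_integral_centered_normal) auto
    also have "\<dots> = (\<integral>\<^sup>+x. ennreal (rev_loewner_functional \<mu> \<zeta> r d' (w + of_real (\<sigma> * x)))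
          \<partial>density lborel std_normal_density)"
      by (subst nn_integral_density) (auto simp: \<sigma>_def real_sqrt_mult mult.assoc)
    also have "\<dots> = (\<integral>\<^sup>+x. ennreal (cmod d' powr \<mu> * Im w powr (\<zeta> - r)) *
          ennreal (cmod (w + of_real (\<sigma> * x)) powr r) \<partial>density lborel std_normal_density)"
      by (simp add: rev_loewner_functional_def ennreal_mult)
    also have "\<dots> = ennreal (cmod d' powr \<mu> * Im w powr (\<zeta> - r)) *
          (\<integral>\<^sup>+x. ennreal (cmod (w + of_real (\<sigma> * x)) powr r) \<partial>density lborel std_normal_density)"
      by (rule nn_integral_cmult) measurable
    also have "\<dots> \<le> ennreal (cmod d' powr \<mu> * Im w powr (\<zeta> - r)) *
        ennreal (cmod w powr r * exp (\<sigma>\<^sup>2 / 2 * (r\<^sup>2 / 2 / (cmod w)\<^sup>2 + r * (r - 2) / 2 * Re (1 / w\<^sup>2))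
          + C1 * (\<sigma> / cmod w) ^ 3))"
      by (intro mult_left_mono C1(2)) (use \<sigma> yw in auto)
    also have "\<dots> = ennreal (rev_loewner_functional \<mu> \<zeta> r d' w * exp (h * B w + C1 * (\<sigma> / cmod w) ^ 3))"
      by (simp add: rev_loewner_functional_def B_def \<sigma>(3) ennreal_mult[symmetric] mult_ac)
    also have "\<dots> \<le> ennreal (rev_loewner_functional \<mu> \<zeta> r d z * exp (C * \<rho> ^ 3))"
    proof (rule ennreal_leI)
      have B_z: "2 * (\<mu> - r) * Re (1 / z\<^sup>2) + 2 * (\<zeta> - r) / (cmod z)\<^sup>2 = - B z"
      proof -
        have e: "2 * (\<mu> - r) = - (\<kappa> * r * (r - 2) / 4)" "2 * (\<zeta> - r) = - (\<kappa> * r\<^sup>2 / 4)"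
          using \<zeta> \<mu> by linarith+
        have "- (\<kappa> * r * (r - 2) / 4) * R + - (\<kappa> * r\<^sup>2 / 4) / N
            = - (\<kappa> / 2 * (r\<^sup>2 / 2 / N + r * (r - 2) / 2 * R))" for R N :: real
          by (cases "N = 0") (simp_all add: field_simps power2_eq_square)
        then show ?thesis unfolding e B_def .
      qed
      have "rev_loewner_functional \<mu> \<zeta> r d' w \<le> rev_loewner_functional \<mu> \<zeta> r d z *
          exp (h * - B z + C2 * (h / y\<^sup>2)\<^sup>2)"
        using euler_step_functional_le[of \<mu> r y z h \<zeta> d] assms y h
        unfolding w_def d'_def C2_def B_z by simp
      then have "rev_loewner_functional \<mu> \<zeta> r d' w * exp (h * B w + C1 * (\<sigma> / cmod w) ^ 3)
          \<le> rev_loewner_functional \<mu> \<zeta> r d z * exp (h * - B z + C2 * (h / y\<^sup>2)\<^sup>2)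
            * exp (h * B w + C1 * (\<sigma> / cmod w) ^ 3)"
        by (rule mult_right_mono) simp
      also have "\<dots> = rev_loewner_functional \<mu> \<zeta> r d z *
          exp (h * (B w - B z) + C2 * (h / y\<^sup>2)\<^sup>2 + C1 * (\<sigma> / cmod w) ^ 3)"
        by (simp add: mult.assoc exp_add[symmetric] algebra_simps)
      also have "\<dots> \<le> rev_loewner_functional \<mu> \<zeta> r d z * exp (C * \<rho> ^ 3)"
      proof (intro mult_left_mono exp_le_cancel_iff[THEN iffD2])
        have "cmod (w - z) \<le> 2 * h / y"
          using h y yz by (auto simp: w_def norm_divide intro!: divide_left_mono mult_pos_pos)
        have D: "cmod (1 / w\<^sup>2 - 1 / z\<^sup>2) \<le> 4 * h / y ^ 4"
        proof -
          have "cmod (1 / w\<^sup>2 - 1 / z\<^sup>2) \<le> 2 * cmod (w - z) / y ^ 3"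
            by (rule norm_inverse_square_diff_le[OF y(1) yw yz])
          also have "\<dots> \<le> 2 * (2 * h / y) / y ^ 3"
            using \<open>cmod (w - z) \<le> 2 * h / y\<close> y by (intro divide_right_mono mult_left_mono) auto
          also have "\<dots> = 4 * h / y ^ 4" by (simp add: power3_eq_cube power4_eq_xxxx)
          finally show ?thesis .
        qed
        have "B w - B z = \<kappa> / 2 * (r\<^sup>2 / 2 * (cmod (1 / w\<^sup>2) - cmod (1 / z\<^sup>2))
            + r * (r - 2) / 2 * Re (1 / w\<^sup>2 - 1 / z\<^sup>2))"
          by (simp add: B_def norm_divide norm_power algebra_simps)
        also have "\<dots> \<le> \<kappa> / 2 * (r\<^sup>2 / 2 * cmod (1 / w\<^sup>2 - 1 / z\<^sup>2)
            + \<bar>r * (r - 2) / 2\<bar> * cmod (1 / w\<^sup>2 - 1 / z\<^sup>2))"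
        proof (intro mult_left_mono add_mono)
          show "r * (r - 2) / 2 * Re (1 / w\<^sup>2 - 1 / z\<^sup>2) \<le> \<bar>r * (r - 2) / 2\<bar> * cmod (1 / w\<^sup>2 - 1 / z\<^sup>2)"
            by (rule order_trans[OF abs_ge_self]) (simp only: abs_mult mult_left_mono abs_Re_le_cmod abs_ge_zero)
        qed (use assms norm_triangle_ineq2 in auto)
        also have "\<dots> = C3 * cmod (1 / w\<^sup>2 - 1 / z\<^sup>2)"
          by (simp add: C3_def algebra_simps)
        also have "\<dots> \<le> C3 * (4 * h / y ^ 4)"
          using D C23 by (intro mult_left_mono)
        finally have "h * (B w - B z) \<le> h * (C3 * (4 * h / y ^ 4))"
          using h by (intro mult_left_mono) auto
        also have "\<dots> = C3 * 4 * (h / y\<^sup>2)\<^sup>2"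
          by (simp add: power2_eq_square power4_eq_xxxx mult_ac)
        finally have one: "h * (B w - B z) \<le> C3 * 4 * (h / y\<^sup>2)\<^sup>2" .
        have rho4: "(h / y\<^sup>2)\<^sup>2 \<le> \<rho> ^ 3"
        proof -
          have "(h / y\<^sup>2)\<^sup>2 = \<rho> ^ 4" unfolding \<rho>(2)[symmetric] by (simp flip: power_mult)
          also have "\<dots> \<le> \<rho> ^ 3" using \<rho> by (intro power_decreasing) auto
          finally show ?thesis .
        qed
        have "(\<sigma> / cmod w) ^ 3 \<le> (\<sigma> / y) ^ 3"
          using \<sigma> yw y by (intro power_mono divide_left_mono mult_pos_pos) auto
        also have "\<dots> = sqrt \<kappa> ^ 3 * \<rho> ^ 3"
          by (simp add: \<sigma>_def \<rho>_def real_sqrt_mult power_divide power_mult_distrib)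
        finally have "C1 * (\<sigma> / cmod w) ^ 3 \<le> C1 * (sqrt \<kappa> ^ 3 * \<rho> ^ 3)"
          using C1(1) by (rule mult_left_mono)
        moreover have "C2 * (h / y\<^sup>2)\<^sup>2 \<le> C2 * \<rho> ^ 3" "C3 * 4 * (h / y\<^sup>2)\<^sup>2 \<le> C3 * 4 * \<rho> ^ 3"
          using rho4 C23 by (auto intro: mult_left_mono)
        ultimately show "h * (B w - B z) + C2 * (h / y\<^sup>2)\<^sup>2 + C1 * (\<sigma> / cmod w) ^ 3 \<le> C * \<rho> ^ 3"
          using one by (simp add: C_def algebra_simps)
      qed (auto simp: rev_loewner_functional_def)
      finally show "rev_loewner_functional \<mu> \<zeta> r d' w * exp (h * B w + C1 * (\<sigma> / cmod w) ^ 3)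
          \<le> rev_loewner_functional \<mu> \<zeta> r d z * exp (C * \<rho> ^ 3)" .
    qed
    finally show ?thesis by (simp only: w_def d'_def \<rho>_def)
  qed
  then show ?thesis by blast
qed

section \<open>Iteration over independent increments\<close>

lemma euler_loewner_cong:
  assumes "\<And>i. i < k \<Longrightarrow> J i = J' i"
  shows "euler_loewner h J k z = euler_loewner h J' k z"
  using assms by (induction k) auto

lemma euler_deriv_cong:
  assumes "\<And>i. i < k \<Longrightarrow> J i = J' i"
  shows "euler_deriv h J k z = euler_deriv h J' k z"
  using assms by (induction k) (auto simp: euler_loewner_cong[of _ J J'])

lemma borel_measurable_euler_loewner:
  assumes "\<And>i. i < k \<Longrightarrow> (\<lambda>\<omega>. J \<omega> i) \<in> borel_measurable M"
  shows "(\<lambda>\<omega>. euler_loewner h (J \<omega>) k z) \<in> borel_measurable M"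
  using assms
proof (induction k)
  case (Suc k)
  then have [measurable]: "(\<lambda>\<omega>. euler_loewner h (J \<omega>) k z) \<in> borel_measurable M"
      "(\<lambda>\<omega>. J \<omega> k) \<in> borel_measurable M" by auto
  show ?case by simp
qed simp

lemma borel_measurable_euler_deriv:
  assumes "\<And>i. i < k \<Longrightarrow> (\<lambda>\<omega>. J \<omega> i) \<in> borel_measurable M"
  shows "(\<lambda>\<omega>. euler_deriv h (J \<omega>) k z) \<in> borel_measurable M"
  using assms
proof (induction k)
  case (Suc k)
  then have [measurable]: "(\<lambda>\<omega>. euler_deriv h (J \<omega>) k z) \<in> borel_measurable M"
      "(\<lambda>\<omega>. euler_loewner h (J \<omega>) k z) \<in> borel_measurable M"
    by (auto intro: borel_measurable_euler_loewner)
  show ?case by simp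
qed simp

lemma (in prob_space) nn_integral_indep_var:
  assumes ind: "indep_var S X T Y" and f: "case_prod f \<in> borel_measurable (S \<Otimes>\<^sub>M T)"
  shows "(\<integral>\<^sup>+\<omega>. f (X \<omega>) (Y \<omega>) \<partial>M) = (\<integral>\<^sup>+\<omega>. (\<integral>\<^sup>+y. f (X \<omega>) y \<partial>distr M T Y) \<partial>M)"
proof -
  have [measurable]: "random_variable S X" "random_variable T Y"
    using ind by (auto dest: indep_var_rv1 indep_var_rv2)
  have f': "case_prod f \<in> borel_measurable (S \<Otimes>\<^sub>M distr M T Y)"
    using f by (simp cong: measurable_cong_sets)
  interpret T: prob_space "distr M T Y" by (rule prob_space_distr) simp
  have "(\<integral>\<^sup>+\<omega>. f (X \<omega>) (Y \<omega>) \<partial>M) = (\<integral>\<^sup>+p. case_prod f p \<partial>distr M (S \<Otimes>\<^sub>M T) (\<lambda>\<omega>. (X \<omega>, Y \<omega>)))"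
    using f by (subst nn_integral_distr) auto
  also have "\<dots> = (\<integral>\<^sup>+p. case_prod f p \<partial>(distr M S X \<Otimes>\<^sub>M distr M T Y))"
    using ind by (simp add: indep_var_distribution_eq)
  also have "\<dots> = (\<integral>\<^sup>+x. (\<integral>\<^sup>+y. f x y \<partial>distr M T Y) \<partial>distr M S X)"
    using f by (subst T.nn_integral_fst[symmetric]) (auto cong: measurable_cong_sets)
  also have "\<dots> = (\<integral>\<^sup>+\<omega>. (\<integral>\<^sup>+y. f (X \<omega>) y \<partial>distr M T Y) \<partial>M)"
    using T.borel_measurable_nn_integral[OF f'] by (subst nn_integral_distr) auto
  finally show ?thesis .
qed

text \<open>
  The state of the scheme after \<open>k\<close> steps is a function of the first \<open>k\<close> increments, hence independent
  of the next one, which can be integrated out first.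
\<close>

lemma (in prob_space) nn_integral_rev_loewner_functional_le:
  fixes F :: "complex \<Rightarrow> complex \<Rightarrow> real"
  assumes F_def: "F = rev_loewner_functional \<mu> \<zeta> r"
    and ind: "indep_vars (\<lambda>_. borel) X {..<n}"
    and normal: "\<And>k. k < n \<Longrightarrow> distributed M lborel (X k) (normal_density 0 (sqrt h))"
    and "0 < Im z" "0 \<le> h" "0 \<le> K"
    and step: "\<And>c d. Im z \<le> Im c \<Longrightarrow>
      (\<integral>\<^sup>+x. ennreal (F (d * (1 + of_real (2 * h) / c\<^sup>2)) (c - of_real (2 * h) / c + of_real (a * x)))
        \<partial>density lborel (normal_density 0 (sqrt h))) \<le> ennreal (F d c * K)"
  shows "k \<le> n \<Longrightarrow> (\<integral>\<^sup>+\<omega>. ennreal (F (euler_deriv h (\<lambda>i. a * X i \<omega>) k z) (euler_loewner h (\<lambda>i. a * X i \<omega>) k z)) \<partial>M)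
    \<le> ennreal (F 1 z * K ^ k)"
proof (induction k)
  case 0
  then show ?case by (simp add: emeasure_space_1)
next
  case (Suc k)
  have F_nonneg: "0 \<le> F d c" for d c by (simp add: F_def rev_loewner_functional_def)
  have F_meas[measurable (raw)]: "(\<lambda>x. F (f x) (g x)) \<in> borel_measurable N"
    if "f \<in> borel_measurable N" "g \<in> borel_measurable N" for f g and N :: "'b measure"
    unfolding F_def using that by measurable
  define D where "D x = euler_deriv h (\<lambda>i. a * x i) k z" for x :: "nat \<Rightarrow> real"
  define c where "c x = euler_loewner h (\<lambda>i. a * x i) k z" for x :: "nat \<Rightarrow> real"
  define S where "S \<omega> = (D (\<lambda>i. X i \<omega>), c (\<lambda>i. X i \<omega>))" for \<omega>
  define G where "G s x = ennreal (F (fst s * (1 + of_real (2 * h) / (snd s)\<^sup>2))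
      (snd s - of_real (2 * h) / snd s + of_real (a * x)))" for s and x :: real
  have X[measurable]: "random_variable borel (X i)" if "i < n" for i
    using ind that by (auto simp: indep_vars_def)
  have comp: "(\<lambda>x. a * x i) \<in> borel_measurable (PiM {..<k} (\<lambda>_. borel))" if "i < k" for i
    using measurable_component_singleton[of i "{..<k}" "\<lambda>_. borel :: real measure"] that by simp
  have [measurable]: "D \<in> borel_measurable (PiM {..<k} (\<lambda>_. borel))" "c \<in> borel_measurable (PiM {..<k} (\<lambda>_. borel))"
    unfolding D_def c_def
    by (intro borel_measurable_euler_deriv borel_measurable_euler_loewner comp; assumption)+
  define R where "R A \<omega> = restrict (\<lambda>i. X i \<omega>) A" for A \<omega>
  have indR: "indep_var (PiM {..<k} (\<lambda>_. borel)) (R {..<k}) (PiM {k} (\<lambda>_. borel)) (R {k})"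
    unfolding R_def by (rule indep_var_restrict[OF ind]) (use Suc.prems in auto)
  \<comment> \<open>Restricting the family of increments to an index set turns it into one random variable, and
    restrictions to disjoint sets are independent.\<close>
  have S_eq: "S \<omega> = (D (R {..<k} \<omega>), c (R {..<k} \<omega>))" for \<omega>
    unfolding S_def D_def c_def R_def by (auto intro!: euler_deriv_cong euler_loewner_cong)
  have law: "distr M borel (X k) = density lborel (normal_density 0 (sqrt h))"
  proof -
    have "distr M borel (X k) = distr M lborel (X k)" by (rule distr_cong) auto
    then show ?thesis using distributed_distr_eq_density[OF normal[of k]] Suc.prems by simp
  qed
  have "(\<integral>\<^sup>+\<omega>. ennreal (F (euler_deriv h (\<lambda>i. a * X i \<omega>) (Suc k) z) (euler_loewner h (\<lambda>i. a * X i \<omega>) (Suc k) z)) \<partial>M)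
      = (\<integral>\<^sup>+\<omega>. G (S \<omega>) (X k \<omega>) \<partial>M)"
    by (simp add: G_def S_def D_def c_def)
  also have "\<dots> = (\<integral>\<^sup>+\<omega>. G (D (R {..<k} \<omega>), c (R {..<k} \<omega>)) (R {k} \<omega> k) \<partial>M)"
    by (simp add: S_eq) (simp add: R_def)
  also have "\<dots> = (\<integral>\<^sup>+\<omega>. (\<integral>\<^sup>+y. G (D (R {..<k} \<omega>), c (R {..<k} \<omega>)) (y k)
      \<partial>distr M (PiM {k} (\<lambda>_. borel)) (R {k})) \<partial>M)"
    by (rule nn_integral_indep_var[OF indR]) (unfold G_def fst_conv snd_conv, measurable)
  also have "\<dots> = (\<integral>\<^sup>+\<omega>. (\<integral>\<^sup>+x. G (S \<omega>) x \<partial>distr M borel (X k)) \<partial>M)"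
  proof (intro nn_integral_cong)
    fix \<omega>
    have [measurable]: "R {k} \<in> measurable M (PiM {k} (\<lambda>_. borel))"
      using indR by (rule indep_var_rv2)
    have [measurable]: "G (S \<omega>) \<in> borel_measurable borel"
      unfolding G_def by measurable
    have [measurable]: "random_variable borel (X k)" using Suc.prems by (intro X) simp
    show "(\<integral>\<^sup>+y. G (D (R {..<k} \<omega>), c (R {..<k} \<omega>)) (y k) \<partial>distr M (PiM {k} (\<lambda>_. borel)) (R {k}))
        = (\<integral>\<^sup>+x. G (S \<omega>) x \<partial>distr M borel (X k))"
      unfolding S_eq[symmetric]
      by (simp add: nn_integral_distr) (simp add: R_def)
  qed
  also have "\<dots> \<le> (\<integral>\<^sup>+\<omega>. ennreal (F (fst (S \<omega>)) (snd (S \<omega>)) * K) \<partial>M)"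
    unfolding law G_def
    by (intro nn_integral_mono step)
      (auto simp: S_def c_def intro!: Im_euler_loewner_mono \<open>0 < Im z\<close> \<open>0 \<le> h\<close>)
  also have "\<dots> = (\<integral>\<^sup>+\<omega>. ennreal (F (fst (S \<omega>)) (snd (S \<omega>))) \<partial>M) * ennreal K"
  proof -
    have "(\<lambda>\<omega>. euler_deriv h (\<lambda>i. a * X i \<omega>) k z) \<in> borel_measurable M"
        "(\<lambda>\<omega>. euler_loewner h (\<lambda>i. a * X i \<omega>) k z) \<in> borel_measurable M"
      using Suc.prems by (auto intro!: borel_measurable_euler_deriv borel_measurable_euler_loewner borel_measurable_times X)
    then show ?thesis
      using \<open>0 \<le> K\<close> F_nonneg
      by (subst nn_integral_multc[symmetric]) (auto simp: S_def D_def c_def ennreal_mult intro!: F_meas)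
  qed
  also have "\<dots> \<le> ennreal (F 1 z * K ^ k) * ennreal K"
    using Suc by (intro mult_right_mono) (auto simp: S_def D_def c_def)
  also have "\<dots> = ennreal (F 1 z * K ^ Suc k)"
    using \<open>0 \<le> K\<close> F_nonneg by (simp add: ennreal_mult[symmetric] mult_ac)
  finally show ?case .
qed

section \<open>The tail estimate for the derivative\<close>

text \<open>
  With \<open>\<tau> = h / c\<^sup>2\<close> each step at \<open>c\<close> multiplies the derivative by \<open>1 + 2 \<tau>\<close> and the imaginary part by \<open>1 + 2 \<bar>\<tau>\<bar>\<close>. A large derivative
  thus forces a large imaginary part.
\<close>

lemma cmod_euler_deriv_le:
  assumes "0 < Im z" "0 \<le> h"
  shows "cmod (euler_deriv h J k z) * Im z \<le> Im (euler_loewner h J k z)"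
proof (induction k)
  case (Suc k)
  let ?c = "euler_loewner h J k z" and ?d = "euler_deriv h J k z"
  have "cmod (1 + of_real (2 * h) / ?c\<^sup>2) \<le> 1 + 2 * h / (cmod ?c)\<^sup>2"
    using norm_triangle_ineq[of 1 "of_real (2 * h) / ?c\<^sup>2"] assms
    by (simp add: norm_divide norm_power norm_mult)
  then have "(cmod ?d * Im z) * cmod (1 + of_real (2 * h) / ?c\<^sup>2)
      \<le> Im ?c * (1 + 2 * h / (cmod ?c)\<^sup>2)"
    using Suc assms Im_euler_loewner_mono[OF assms, of J k] by (intro mult_mono) auto
  then show ?case
    unfolding euler_loewner.simps euler_deriv.simps Im_euler_step norm_mult
    by (simp only: mult_ac)
qed simp

text \<open>
  The discrete version of \<open>Y\<^sub>t\<^sup>2 \<le> Y\<^sub>0\<^sup>2 + 4 t\<close>.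
\<close>

lemma Im_euler_loewner_power2_le:
  assumes "0 < Im z" "0 \<le> h"
  shows "(Im (euler_loewner h J k z))\<^sup>2 \<le> (Im z)\<^sup>2 + real k * (4 * h + 4 * h\<^sup>2 / (Im z)\<^sup>2)"
proof (induction k)
  case (Suc k)
  let ?c = "euler_loewner h J k z"
  have c: "Im z \<le> Im ?c" by (rule Im_euler_loewner_mono[OF assms])
  then have c0: "0 < Im ?c" using assms by linarith
  have "Im ?c * (2 * h / (cmod ?c)\<^sup>2) \<le> Im ?c * (2 * h / (Im ?c)\<^sup>2)"
    using c0 assms abs_Im_le_cmod[of ?c]
    by (intro mult_left_mono divide_left_mono power_mono mult_pos_pos) auto
  also have "\<dots> = 2 * h / Im ?c" using c0 by (simp add: power2_eq_square)
  finally have "Im ?c * (1 + 2 * h / (cmod ?c)\<^sup>2) \<le> Im ?c + 2 * h / Im ?c"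
    by (simp add: algebra_simps)
  then have "(Im ?c * (1 + 2 * h / (cmod ?c)\<^sup>2))\<^sup>2 \<le> (Im ?c + 2 * h / Im ?c)\<^sup>2"
    using c0 assms by (intro power_mono) auto
  also have "\<dots> = (Im ?c)\<^sup>2 + (4 * h + 4 * h\<^sup>2 / (Im ?c)\<^sup>2)"
    using c0 by (simp add: power2_eq_square field_simps)
  also have "4 * h\<^sup>2 / (Im ?c)\<^sup>2 \<le> 4 * h\<^sup>2 / (Im z)\<^sup>2"
    using c assms by (intro divide_left_mono power_mono mult_pos_pos) auto
  finally show ?case
    using Suc by (simp only: euler_loewner.simps Im_euler_step) (simp add: algebra_simps add_divide_distrib)
qed simp

text \<open>
  If the derivative exceeds \<open>y powr (- (1 - \<epsilon>))\<close>, then \<open>Im c\<close> lies between \<open>y powr \<epsilon>\<close> and \<open>3\<close>, so the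
  factor \<open>Im c powr \<zeta>\<close> costs at most a power \<open>\<epsilon> * \<bar>\<zeta>\<bar>\<close> of \<open>y\<close> whatever the sign of \<open>\<zeta>\<close>. The remaining factor,
  a power of \<open>cmod c / Im c\<close>, is at least \<open>1\<close>.
\<close>

lemma rev_loewner_functional_lower_bound:
  assumes "0 \<le> \<mu>" "0 \<le> r" and y: "0 < y" "y < 1" and "0 \<le> \<epsilon>"
    and d: "y powr (- (1 - \<epsilon>)) \<le> cmod d" and dc: "cmod d * y \<le> Im c" and c: "Im c \<le> 3"
  shows "y powr (- (1 - \<epsilon>) * \<mu> + \<epsilon> * \<bar>\<zeta>\<bar>) / 3 powr \<bar>\<zeta>\<bar> \<le> rev_loewner_functional \<mu> \<zeta> r d c"
proof -
  have low: "y powr \<epsilon> \<le> Im c"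
  proof -
    have "y powr \<epsilon> = y powr (- (1 - \<epsilon>)) * y"
      using y powr_add[of y "- (1 - \<epsilon>)" 1] by simp
    also have "\<dots> \<le> cmod d * y" using d y by (intro mult_right_mono) auto
    finally show ?thesis using dc by linarith
  qed
  have "0 < y powr \<epsilon>" using y by simp
  with low have c0: "0 < Im c" by linarith
  have "y powr (\<epsilon> * \<bar>\<zeta>\<bar>) * (1 / 3 powr \<bar>\<zeta>\<bar>) \<le> Im c powr \<zeta>"
  proof (cases "0 \<le> \<zeta>")
    case True
    have "y powr (\<epsilon> * \<bar>\<zeta>\<bar>) * (1 / 3 powr \<bar>\<zeta>\<bar>) \<le> y powr (\<epsilon> * \<bar>\<zeta>\<bar>) * 1"
      by (intro mult_left_mono) (auto simp: ge_one_powr_ge_zero)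
    also have "\<dots> = (y powr \<epsilon>) powr \<zeta>" using True by (simp add: powr_powr)
    also have "\<dots> \<le> Im c powr \<zeta>" using low True by (intro powr_mono2) auto
    finally show ?thesis .
  next
    case False
    have "y powr (\<epsilon> * \<bar>\<zeta>\<bar>) \<le> 1" using y \<open>0 \<le> \<epsilon>\<close> by (intro powr_le1) auto
    then have "y powr (\<epsilon> * \<bar>\<zeta>\<bar>) * (1 / 3 powr \<bar>\<zeta>\<bar>) \<le> 1 * (1 / 3 powr \<bar>\<zeta>\<bar>)"
      by (rule mult_right_mono) simp
    also have "\<dots> = 3 powr \<zeta>" using False by (simp add: powr_minus_divide[symmetric])
    also have "\<dots> \<le> Im c powr \<zeta>" using c c0 False by (intro powr_mono2') auto
    finally show ?thesis .
  qed
  moreover have "y powr (- (1 - \<epsilon>) * \<mu>) \<le> cmod d powr \<mu>"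
  proof -
    have "y powr (- (1 - \<epsilon>) * \<mu>) = (y powr (- (1 - \<epsilon>))) powr \<mu>" by (simp add: powr_powr)
    also have "\<dots> \<le> cmod d powr \<mu>" using d assms(1) by (intro powr_mono2) auto
    finally show ?thesis .
  qed
  ultimately have "y powr (- (1 - \<epsilon>) * \<mu>) * (y powr (\<epsilon> * \<bar>\<zeta>\<bar>) * (1 / 3 powr \<bar>\<zeta>\<bar>))
      \<le> cmod d powr \<mu> * Im c powr \<zeta>"
    by (intro mult_mono) auto
  also have "Im c powr \<zeta> = Im c powr (\<zeta> - r) * Im c powr r"
    using c0 by (simp add: powr_add[symmetric])
  also have "cmod d powr \<mu> * (Im c powr (\<zeta> - r) * Im c powr r)
      \<le> cmod d powr \<mu> * (Im c powr (\<zeta> - r) * cmod c powr r)"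
    using c0 assms(2) abs_Im_le_cmod[of c] by (intro mult_left_mono powr_mono2) auto
  finally show ?thesis
    using y by (simp add: rev_loewner_functional_def powr_add mult.assoc)
qed

lemma (in finite_measure) measure_le_of_nn_integral_le:
  assumes A: "A \<in> sets M" and "0 < b" "0 \<le> v" and ge: "\<And>\<omega>. \<omega> \<in> A \<Longrightarrow> b \<le> f \<omega>"
    and int: "(\<integral>\<^sup>+\<omega>. ennreal (f \<omega>) \<partial>M) \<le> ennreal v"
  shows "measure M A \<le> v / b"
proof -
  have "ennreal (b * measure M A) = (\<integral>\<^sup>+\<omega>. ennreal b * indicator A \<omega> \<partial>M)"
    using A \<open>0 < b\<close> by (simp add: nn_integral_cmult_indicator emeasure_eq_measure ennreal_mult)
  also have "\<dots> \<le> (\<integral>\<^sup>+\<omega>. ennreal (f \<omega>) \<partial>M)"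
    using ge by (intro nn_integral_mono) (auto simp: indicator_def ennreal_leI)
  also have "\<dots> \<le> ennreal v" by (rule int)
  finally show ?thesis using \<open>0 < b\<close> \<open>0 \<le> v\<close> by (simp add: field_simps)
qed

text \<open>
  Fatou's lemma for events: \<open>E\<close> is contained in the increasing union of the sets \<open>I N\<close>, each of which
  lies in some \<open>A n\<close> of measure at most \<open>b\<close>.
\<close>

lemma (in finite_measure) measure_le_of_eventually_in:
  assumes A: "\<And>n. A n \<in> sets M" and le: "\<forall>\<^sub>F n in sequentially. measure M (A n) \<le> b"
    and ev: "\<And>\<omega>. \<omega> \<in> E \<Longrightarrow> \<forall>\<^sub>F n in sequentially. \<omega> \<in> A n"
  shows "measure M E \<le> b"
proof -
  define I where "I N = (\<Inter>n\<in>{N..}. A n)" for N :: nat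
  have I: "I N \<in> sets M" for N
    unfolding I_def using A by (intro sets.countable_INT') auto
  have inc: "incseq I" by (auto simp: incseq_def I_def)
  have I_le: "measure M (I N) \<le> b" for N
  proof -
    obtain n where "N \<le> n" "measure M (A n) \<le> b"
      using le unfolding eventually_sequentially by (meson nat_le_linear)
    then show ?thesis
      using finite_measure_mono[of "I N" "A n"] A by (force simp: I_def)
  qed
  have "(\<lambda>N. measure M (I N)) \<longlonglongrightarrow> measure M (\<Union>N. I N)"
    using I inc by (intro finite_Lim_measure_incseq) auto
  then have "measure M (\<Union>N. I N) \<le> b"
    by (rule LIMSEQ_le_const2) (use I_le in auto)
  moreover have "E \<subseteq> (\<Union>N. I N)"
    using ev by (fastforce simp: I_def eventually_sequentially)
  then have "measure M E \<le> measure M (\<Union>N. I N)"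
    using I by (intro finite_measure_mono) auto
  ultimately show ?thesis by linarith
qed

lemma (in prob_space) indep_vars_reindex_inj:
  assumes ind: "indep_vars N X (f ` I)" and f: "inj_on f I"
  shows "indep_vars (\<lambda>i. N (f i)) (\<lambda>i. X (f i)) I"
proof -
  have "indep_vars (\<lambda>i. PiM {f i} N) (\<lambda>i \<omega>. restrict (\<lambda>j. X j \<omega>) {f i}) I"
    by (rule indep_vars_restrict[OF ind]) (use f in \<open>auto simp: disjoint_family_on_def inj_on_def\<close>)
  then have "indep_vars (\<lambda>i. N (f i)) (\<lambda>i \<omega>. restrict (\<lambda>j. X j \<omega>) {f i} (f i)) I"
    by (rule indep_vars_compose2[where Y = "\<lambda>i x. x (f i)"]) (rule measurable_component_singleton, simp)
  then show ?thesis by simp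
qed

text \<open>
  The increments along a uniform grid, taken backward from time \<open>t\<close> in the order in which the reverse
  scheme uses them.
\<close>

lemma (in standard_brownian_motion) reversed_increments:
  fixes t h :: real and n :: nat
  assumes "0 < t"
  defines "h \<equiv> t / Suc n"
  defines "X \<equiv> \<lambda>k \<omega>. B (t - k * h) \<omega> - B (t - Suc k * h) \<omega>"
  shows "indep_vars (\<lambda>_. borel) X {..<Suc n}"
    and "\<And>k. k < Suc n \<Longrightarrow> distributed M lborel (X k) (normal_density 0 (sqrt h))"
proof -
  have h: "0 < h" "t = Suc n * h" using assms by (auto simp: h_def)
  let ?\<tau> = "\<lambda>i. real i * h"
  have X_eq: "X k = (\<lambda>\<omega>. B (?\<tau> (Suc (n - k))) \<omega> - B (?\<tau> (n - k)) \<omega>)" if "k < Suc n" for k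
  proof -
    have "t - k * h = ?\<tau> (Suc (n - k))" "t - Suc k * h = ?\<tau> (n - k)"
      using that by (auto simp: h(2) of_nat_diff algebra_simps)
    then show ?thesis by (simp add: X_def)
  qed
  have "indep_vars (\<lambda>_. borel) (\<lambda>i \<omega>. B (?\<tau> (Suc i)) \<omega> - B (?\<tau> i) \<omega>) {..<Suc n}"
    using h(1) by (intro independent_increments) (auto intro!: monoI mult_right_mono)
  moreover have "{..<Suc n} = (\<lambda>k. n - k) ` {..<Suc n}"
  proof -
    have "i \<in> (\<lambda>k. n - k) ` {..<Suc n}" if "i < Suc n" for i
      using that by (intro image_eqI[of _ _ "n - i"]) auto
    then show ?thesis by auto
  qed
  ultimately have "indep_vars (\<lambda>_. borel) (\<lambda>i \<omega>. B (?\<tau> (Suc i)) \<omega> - B (?\<tau> i) \<omega>) ((\<lambda>k. n - k) ` {..<Suc n})"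
    by simp
  then have "indep_vars (\<lambda>_. borel) (\<lambda>k \<omega>. B (?\<tau> (Suc (n - k))) \<omega> - B (?\<tau> (n - k)) \<omega>) {..<Suc n}"
    by (rule indep_vars_reindex_inj) (auto simp: inj_on_def)
  then show "indep_vars (\<lambda>_. borel) X {..<Suc n}"
    by (rule indep_vars_cong[THEN iffD1, rotated -1]) (auto simp: X_eq)
  fix k assume k: "k < Suc n"
  show "distributed M lborel (X k) (normal_density 0 (sqrt h))"
    using gaussian_increments[of "?\<tau> (n - k)" "?\<tau> (Suc (n - k))"] h(1)
    by (simp add: X_eq[OF k] algebra_simps)
qed

theorem theorem1p4:
  fixes \<kappa> q :: real and M :: "'a measure" and B :: "real \<Rightarrow> 'a \<Rightarrow> real"
    and \<xi> :: "'a \<Rightarrow> real \<Rightarrow> real"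
  assumes "\<kappa> > 0" and "\<kappa> \<noteq> 8"
    and "standard_brownian_motion M B"
    and "\<And>\<omega> t. \<xi> \<omega> t = sqrt \<kappa> * B t \<omega>"
    and "q = 4 / \<kappa> + \<kappa> / 16 + 1"
  shows "\<forall>\<delta>>0. \<exists>C>0. \<exists>\<epsilon>>0. \<forall>t\<in>{0..1}. \<forall>y\<in>{0<..<1}.
           measure M {\<omega> \<in> space M.
               cmod (deriv (loewner_fhat (\<xi> \<omega>) t) (\<i> * complex_of_real y)) > y powr (- (1 - \<epsilon>))}
             \<le> C * y powr (q - \<delta>)"
proof (intro allI impI)
  fix \<delta> :: real assume "\<delta> > 0"
  interpret standard_brownian_motion M B by fact
  note \<xi> = assms(4)
  have \<xi>_cont: "continuous_on {0..} (\<xi> \<omega>)" if "\<omega> \<in> space M" for \<omega>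
    using continuous_on_mult_left[OF continuous_paths[OF that], of "sqrt \<kappa>"] by (simp add: \<xi>[abs_def])
  \<comment> \<open>\<open>\<mu>\<close> and \<open>\<zeta>\<close> are the solutions of the two equations that make drift and diffusion cancel; the
    resulting exponent \<open>\<zeta> + \<mu>\<close> is a concave quadratic in \<open>r\<close>, and this \<open>r\<close> maximises it.\<close>
  define r where "r = 4 / \<kappa> + 1 / 2"
  define \<mu> where "\<mu> = r + \<kappa> * r / 4 - \<kappa> * r\<^sup>2 / 8"
  define \<zeta> where "\<zeta> = r - \<kappa> * r\<^sup>2 / 8"
  have r: "0 < r" using \<open>\<kappa> > 0\<close> by (simp add: r_def add_pos_pos)
  have \<kappa>r: "\<kappa> * r = 4 + \<kappa> / 2" using \<open>\<kappa> > 0\<close> by (simp add: r_def field_simps)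
  have "\<mu> = r * (1 / 2 + 3 * \<kappa> / 16)"
  proof -
    have "\<mu> = r * (1 + \<kappa> / 4 - (\<kappa> * r) / 8)" by (simp add: \<mu>_def power2_eq_square algebra_simps)
    then show ?thesis unfolding \<kappa>r by (simp add: field_simps)
  qed
  then have \<mu>: "0 < \<mu>" using r \<open>\<kappa> > 0\<close> by (simp add: add_pos_pos)
  have sum: "\<zeta> + \<mu> = q"
  proof -
    have "\<zeta> + \<mu> = r * (2 + \<kappa> / 4 - (\<kappa> * r) / 4)" by (simp add: \<mu>_def \<zeta>_def power2_eq_square algebra_simps)
    also have "\<dots> = q" unfolding \<kappa>r assms(5) r_def using \<open>\<kappa> > 0\<close> by (simp add: field_simps power2_eq_square)
    finally show ?thesis .
  qed
  let ?F = "rev_loewner_functional \<mu> \<zeta> r"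
  obtain K where K: "\<And>y h z d. 0 < y \<Longrightarrow> y \<le> Im z \<Longrightarrow> 0 < h \<Longrightarrow> h \<le> y\<^sup>2 / 4 \<Longrightarrow> \<kappa> * h \<le> y\<^sup>2 \<Longrightarrow>
    (\<integral>\<^sup>+x. ennreal (?F (d * (1 + of_real (2 * h) / z\<^sup>2)) (z - of_real (2 * h) / z + of_real (sqrt \<kappa> * x)))
        \<partial>density lborel (normal_density 0 (sqrt h))) \<le> ennreal (?F d z * exp (K * (sqrt h / y) ^ 3))"
  proof -
    have "\<kappa> * r\<^sup>2 / 4 + 2 * (\<zeta> - r) = 0" "\<kappa> * r * (r - 2) / 4 + 2 * (\<mu> - r) = 0"
      by (simp_all add: \<mu>_def \<zeta>_def power2_eq_square field_simps)
    from nn_integral_rev_loewner_functional_step_le[OF \<open>\<kappa> > 0\<close> r less_imp_le[OF \<mu>] this]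
    show ?thesis using that by blast
  qed
  \<comment> \<open>The bound \<open>1/2\<close> serves only to keep \<open>\<epsilon>\<close> below \<open>1\<close>.\<close>
  define \<epsilon> where "\<epsilon> = min (1 / 2) (\<delta> / (\<mu> + \<bar>\<zeta>\<bar>))"
  have \<epsilon>: "0 < \<epsilon>" "\<epsilon> < 1" using \<open>\<delta> > 0\<close> \<mu> by (auto simp: \<epsilon>_def add_pos_nonneg)
  have \<epsilon>\<delta>: "\<epsilon> * (\<mu> + \<bar>\<zeta>\<bar>) \<le> \<delta>"
  proof -
    have "\<epsilon> \<le> \<delta> / (\<mu> + \<bar>\<zeta>\<bar>)" by (simp add: \<epsilon>_def)
    then show ?thesis using \<mu> by (simp add: pos_le_divide_eq add_pos_nonneg)
  qed
  define C where "C = 2 * 3 powr \<bar>\<zeta>\<bar>"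
  have "measure M {\<omega> \<in> space M.
      cmod (deriv (loewner_fhat (\<xi> \<omega>) t) (\<i> * complex_of_real y)) > y powr (- (1 - \<epsilon>))}
      \<le> C * y powr (q - \<delta>)" (is "measure M ?E \<le> _")
    if t: "t \<in> {0..1}" and y: "y \<in> {0<..<1}" for t y
  proof -
    define z where "z = \<i> * complex_of_real y"
    have z: "Im z = y" "cmod z = y" using y by (auto simp: z_def norm_mult)
    define h where "h n = t / Suc n" for n
    define D where "D n \<omega> = euler_deriv (h n) (\<lambda>k. \<xi> \<omega> (t - k * h n) - \<xi> \<omega> (t - Suc k * h n)) (Suc n) z" for n \<omega>
    have D_lim: "(\<lambda>n. D n \<omega>) \<longlonglongrightarrow> deriv (loewner_fhat (\<xi> \<omega>) t) z" if "\<omega> \<in> space M" for \<omega>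
      unfolding D_def h_def using euler_deriv_tendsto[OF \<xi>_cont[OF that], of t z] t y z by simp
    show ?thesis
    \<comment> \<open>For \<open>t = 0\<close> the increments are not Gaussian, but the derivative of the scheme is \<open>1\<close> and the event is empty.\<close>
    proof (cases "t = 0")
      case True
      have "euler_deriv 0 J k z = 1" for J k by (induction k) auto
      then have "D n \<omega> = 1" for n \<omega> unfolding D_def using True by (simp only: h_def div_0)
      then have "deriv (loewner_fhat (\<xi> \<omega>) t) z = 1" if "\<omega> \<in> space M" for \<omega>
        using D_lim[OF that] by (simp add: LIMSEQ_const_iff)
      moreover have "1 \<le> y powr (- (1 - \<epsilon>))"
        using powr_mono'[of "- (1 - \<epsilon>)" 0 y] y \<epsilon> by simp
      ultimately have empty: "?E = {}" by (auto simp: z_def)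
      show ?thesis unfolding empty by (simp add: C_def)
    next
      case False
      then have t0: "0 < t" "t \<le> 1" using t by auto
      define X where "X n k \<omega> = B (t - real k * h n) \<omega> - B (t - real (Suc k) * h n) \<omega>" for n k \<omega>
      define c where "c n \<omega> = euler_loewner (h n) (\<lambda>k. sqrt \<kappa> * X n k \<omega>) (Suc n) z" for n \<omega>
      have D_eq: "D n \<omega> = euler_deriv (h n) (\<lambda>k. sqrt \<kappa> * X n k \<omega>) (Suc n) z" for n \<omega>
        by (simp only: D_def X_def \<xi> right_diff_distrib)
      have h0: "0 < h n" for n using t0 by (simp add: h_def)
      have X_ind: "indep_vars (\<lambda>_. borel) (X n) {..<Suc n}" for n
        unfolding X_def[abs_def] h_def by (rule reversed_increments(1)[OF t0(1)])
      have X_normal: "distributed M lborel (X n k) (normal_density 0 (sqrt (h n)))" if "k < Suc n" for n k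
        unfolding X_def[abs_def] h_def using that by (rule reversed_increments(2)[OF t0(1)])
      have X_meas: "random_variable borel (X n k)" if "k < Suc n" for n k
        using X_ind[of n] that by (auto simp: indep_vars_def)
      define b where "b = y powr (- (1 - \<epsilon>) * \<mu> + \<epsilon> * \<bar>\<zeta>\<bar>) / 3 powr \<bar>\<zeta>\<bar>"
      have b: "0 < b" using y by (simp add: b_def)
      define A where "A n = {\<omega> \<in> space M. y powr (- (1 - \<epsilon>)) < cmod (D n \<omega>)}" for n
      have A: "A n \<in> sets M" for n
      proof -
        have [measurable]: "D n \<in> borel_measurable M"
          unfolding D_eq[abs_def] by (intro borel_measurable_euler_deriv borel_measurable_times X_meas) auto
        show ?thesis unfolding A_def by measurable
      qed
      have h_lim: "h \<longlonglongrightarrow> 0"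
        using LIMSEQ_Suc[OF lim_const_over_n[of t]] by (simp add: h_def[abs_def])
      have ev1: "\<forall>\<^sub>F n in sequentially. h n < y\<^sup>2 / 4"
        by (rule order_tendstoD[OF h_lim]) (use y in auto)
      have ev2: "\<forall>\<^sub>F n in sequentially. h n < y\<^sup>2 / \<kappa>"
        by (rule order_tendstoD[OF h_lim]) (use y \<open>\<kappa> > 0\<close> in auto)
      have "(\<lambda>n. exp (K * t * sqrt (h n) / y ^ 3)) \<longlonglongrightarrow> exp (K * t * sqrt 0 / y ^ 3)"
        by (intro tendsto_intros h_lim) (use y in auto)
      \<comment> \<open>The accumulated factor of the one-step bounds tends to \<open>1\<close>; any bound above \<open>1\<close> would do.\<close>
      then have ev3: "\<forall>\<^sub>F n in sequentially. exp (K * t * sqrt (h n) / y ^ 3) < 2"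
        by (rule order_tendstoD) simp
      have "\<forall>\<^sub>F n in sequentially. measure M (A n) \<le> 2 * y powr \<zeta> / b"
        using ev1 ev2 ev3
      proof eventually_elim
        case (elim n)
        have "(\<integral>\<^sup>+\<omega>. ennreal (?F (D n \<omega>) (c n \<omega>)) \<partial>M) \<le> ennreal (?F 1 z * exp (K * (sqrt (h n) / y) ^ 3) ^ Suc n)"
          unfolding D_eq c_def
        proof (rule nn_integral_rev_loewner_functional_le[OF refl X_ind X_normal])
          show "(\<integral>\<^sup>+x. ennreal (?F (d * (1 + of_real (2 * h n) / c\<^sup>2)) (c - of_real (2 * h n) / c + of_real (sqrt \<kappa> * x)))
            \<partial>density lborel (normal_density 0 (sqrt (h n)))) \<le> ennreal (?F d c * exp (K * (sqrt (h n) / y) ^ 3))"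
            if "Im z \<le> Im c" for c d
            using that z(1) y h0[of n] elim \<open>\<kappa> > 0\<close> by (intro K) (auto simp: pos_less_divide_eq mult.commute)
        qed (use y z h0[of n] in auto)
        also have "exp (K * (sqrt (h n) / y) ^ 3) ^ Suc n = exp (K * t * sqrt (h n) / y ^ 3)"
        proof -
          have "real (Suc n) * (sqrt (h n)) ^ 3 = (real (Suc n) * h n) * sqrt (h n)"
            using h0[of n] by (simp add: power3_eq_cube)
          also have "real (Suc n) * h n = t" by (simp add: h_def)
          finally have "real (Suc n) * (K * (sqrt (h n) / y) ^ 3) = K * t * sqrt (h n) / y ^ 3"
            by (simp add: power_divide mult.left_commute mult.assoc)
          then show ?thesis by (simp only: exp_of_nat_mult[symmetric])
        qed
        also have "?F 1 z = y powr \<zeta>"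
          using y by (simp add: rev_loewner_functional_def z powr_add[symmetric])
        also have "ennreal (y powr \<zeta> * exp (K * t * sqrt (h n) / y ^ 3)) \<le> ennreal (y powr \<zeta> * 2)"
          using elim(3) by (intro ennreal_leI mult_left_mono) auto
        finally have "(\<integral>\<^sup>+\<omega>. ennreal (?F (D n \<omega>) (c n \<omega>)) \<partial>M) \<le> ennreal (2 * y powr \<zeta>)"
          by (simp add: mult.commute)
        then show "measure M (A n) \<le> 2 * y powr \<zeta> / b"
        proof (rule measure_le_of_nn_integral_le[OF A b, rotated 2])
          fix \<omega> assume "\<omega> \<in> A n"
          show "b \<le> ?F (D n \<omega>) (c n \<omega>)"
            unfolding b_def
          proof (rule rev_loewner_functional_lower_bound)
            show "cmod (D n \<omega>) * y \<le> Im (c n \<omega>)"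
              using cmod_euler_deriv_le[of z "h n" "\<lambda>k. sqrt \<kappa> * X n k \<omega>" "Suc n"] h0[of n] z y
              by (simp only: D_eq c_def) simp
            have "(Im (c n \<omega>))\<^sup>2 \<le> y\<^sup>2 + real (Suc n) * (4 * h n + 4 * (h n)\<^sup>2 / y\<^sup>2)"
              using Im_euler_loewner_power2_le[of z "h n" "\<lambda>k. sqrt \<kappa> * X n k \<omega>" "Suc n"] h0[of n] z y
              by (simp only: c_def) simp
            also have "real (Suc n) * (4 * h n + 4 * (h n)\<^sup>2 / y\<^sup>2) = t * (4 + 4 * h n / y\<^sup>2)"
            proof -
              have "real (Suc n) * h n = t" by (simp add: h_def)
              then have "t * (4 + 4 * h n / y\<^sup>2) = real (Suc n) * h n * (4 + 4 * h n / y\<^sup>2)" by simp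
              then show ?thesis by (simp add: power2_eq_square algebra_simps)
            qed
            also have "t * (4 + 4 * h n / y\<^sup>2) \<le> 1 * (4 + 1)"
            proof (intro mult_mono)
              show "4 + 4 * h n / y\<^sup>2 \<le> 4 + 1" using elim(1) y by (simp add: divide_le_eq)
            qed (use t0 h0[of n] in auto)
            \<comment> \<open>The square of the imaginary part is at most \<open>6\<close>, whence the constant \<open>3\<close>.\<close>
            also have "y\<^sup>2 + 1 * (4 + 1) \<le> 3\<^sup>2" using y power_le_one[of y 2] by simp
            finally have "(Im (c n \<omega>))\<^sup>2 \<le> 3\<^sup>2" by simp
            then show "Im (c n \<omega>) \<le> 3" by (rule power2_le_imp_le) simp
          qed (use \<open>\<omega> \<in> A n\<close> \<mu> r y \<epsilon> in \<open>auto simp: A_def\<close>)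
        qed simp
      qed
      then have "measure M ?E \<le> 2 * y powr \<zeta> / b"
      proof (rule measure_le_of_eventually_in[OF A])
        fix \<omega> assume \<omega>: "\<omega> \<in> ?E"
        then have "(\<lambda>n. cmod (D n \<omega>)) \<longlonglongrightarrow> cmod (deriv (loewner_fhat (\<xi> \<omega>) t) z)"
          by (intro tendsto_norm D_lim) auto
        then have "\<forall>\<^sub>F n in sequentially. y powr (- (1 - \<epsilon>)) < cmod (D n \<omega>)"
          by (rule order_tendstoD) (use \<omega> in \<open>auto simp: z_def\<close>)
        then show "\<forall>\<^sub>F n in sequentially. \<omega> \<in> A n"
          using \<omega> by (auto simp: A_def elim: eventually_mono)
      qed
      also have "2 * y powr \<zeta> / b = C * y powr (q - \<epsilon> * (\<mu> + \<bar>\<zeta>\<bar>))"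
      proof -
        have "y powr (q - \<epsilon> * (\<mu> + \<bar>\<zeta>\<bar>)) = y powr (\<zeta> - (- (1 - \<epsilon>) * \<mu> + \<epsilon> * \<bar>\<zeta>\<bar>))"
          unfolding sum[symmetric] by (simp add: algebra_simps)
        also have "\<dots> = y powr \<zeta> / y powr (- (1 - \<epsilon>) * \<mu> + \<epsilon> * \<bar>\<zeta>\<bar>)"
          by (rule powr_diff)
        finally show ?thesis by (simp add: b_def C_def)
      qed
      also have "\<dots> \<le> C * y powr (q - \<delta>)"
        using y \<epsilon>\<delta> by (intro mult_left_mono powr_mono') (auto simp: C_def)
      finally show ?thesis .
    qed
  qed
  moreover have "0 < C" by (simp add: C_def)
  ultimately show "\<exists>C>0. \<exists>\<epsilon>>0. \<forall>t\<in>{0..1}. \<forall>y\<in>{0<..<1}.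
           measure M {\<omega> \<in> space M.
               cmod (deriv (loewner_fhat (\<xi> \<omega>) t) (\<i> * complex_of_real y)) > y powr (- (1 - \<epsilon>))}
             \<le> C * y powr (q - \<delta>)"
    using \<epsilon>(1) by blast
qed

end
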